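(* Let $w:\mathbb{R}\to[0,\infty)$ be a non-negative, locally integrable function. The following are equivalent: (i) $w\in A_\infty^+$, i.e. $[w]_{A_\infty^+}<+\infty$. (ii) There exist $\delta>0$, a constant $C>0$ and $\alpha_1\in(0,1)$ such that $\mathsf{C}_w^+(\alpha)-1\le C(1-\alpha)^\delta$ for all $\alpha\in(\alpha_1,1)$. (iii) There exists $\alpha_o\in(0,1)$ such that $\mathsf{C}_w^+(\alpha_o)<+\infty$.
   Context: Write $w(E)=\int_E w(t)\,dt$ for measurable $E\subseteq\mathbb{R}$ and $w(a,b)=\int_{(a,b)}w(t)\,dt$. The indicator function of $E$ is $\mathbf{1}_E$. For $f\in L^1_{\mathrm{loc}}(\mathbb{R})$ the forward and backward one-sided Hardy-Littlewood maximal operators are $$\mathsf{M}^+f(x)=\sup_{h>0}\frac1h\int_x^{x+h}|f(t)|\,dt,\qquad \mathsf{M}^-f(x)=\sup_{h>0}\frac1h\int_{x-h}^{x}|f(t)|\,dt,\qquad x\in\mathbb{R}.$$ The (Fujii-Wilson type) one-sided $A_\infty^+$ constant is $$[w]_{A_\infty^+}=\sup_{a<b}\frac{1}{w(a,b)}\int_{(a,b)}\mathsf{M}^-(w\mathbf{1}_{(a,b)})(x)\,dx,$$ where intervals with $w(a,b)=0$ contribute $0$ (convention $0/0=0$), and $w\in A_\infty^+$ means $[w]_{A_\infty^+}<+\infty$. The sharp weighted tauberian constant of $\mathsf{M}^+$ is, for $\alpha\in(0,1)$, $$\mathsf{C}_w^+(\alpha)=\sup_{0<w(E)<+\infty}\frac{1}{w(E)}\,w(\{x\in\mathbb{R}:\mathsf{M}^+\mathbf{1}_E(x)>\alpha\}),$$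 the supremum being over measurable sets $E\subseteq\mathbb{R}$ with $0<w(E)<+\infty$. *)

theory Defs
  imports "HOL-Analysis.Analysis"
begin

definition locally_integrable :: "(real \<Rightarrow> real) \<Rightarrow> bool" where
  "locally_integrable f \<longleftrightarrow> (\<forall>K. compact K \<longrightarrow> f absolutely_integrable_on K)"

text \<open>All integrals are Lebesgue integrals of nonnegative functions with values in
  \<^typ>\<open>ennreal\<close>, so that possibly infinite weights, averages and suprema are genuine
  extended values.\<close>

definition weight_of :: "(real \<Rightarrow> real) \<Rightarrow> real set \<Rightarrow> ennreal" where
  "weight_of w E = (\<integral>\<^sup>+ t \<in> E. ennreal (w t) \<partial>lebesgue)"

definition maximal_forward :: "(real \<Rightarrow> real) \<Rightarrow> real \<Rightarrow> ennreal" where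
  "maximal_forward f x =
     (SUP h \<in> {0<..}. (\<integral>\<^sup>+ t \<in> {x..x + h}. ennreal \<bar>f t\<bar> \<partial>lebesgue) / ennreal h)"

definition maximal_backward :: "(real \<Rightarrow> real) \<Rightarrow> real \<Rightarrow> ennreal" where
  "maximal_backward f x =
     (SUP h \<in> {0<..}. (\<integral>\<^sup>+ t \<in> {x - h..x}. ennreal \<bar>f t\<bar> \<partial>lebesgue) / ennreal h)"

text \<open>If \<open>w(a,b) = 0\<close>, the numerator below vanishes too, and \<open>0 / 0 = 0\<close> holds in
  \<^typ>\<open>ennreal\<close>; such intervals therefore contribute \<open>0\<close>.\<close>

definition A_infty_plus_const :: "(real \<Rightarrow> real) \<Rightarrow> ennreal" where
  "A_infty_plus_const w =
     (SUP (a, b) \<in> {(a, b). a < b}.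
        (\<integral>\<^sup>+ x \<in> {a<..<b}.
            maximal_backward (\<lambda>t. w t * indicator {a<..<b} t) x \<partial>lebesgue)
        / weight_of w {a<..<b})"

definition A_infty_plus :: "(real \<Rightarrow> real) \<Rightarrow> bool" where
  "A_infty_plus w \<longleftrightarrow> A_infty_plus_const w < \<infinity>"

text \<open>If \<open>w = 0\<close> almost everywhere there is no admissible \<open>E\<close> and the supremum is \<open>0\<close>.\<close>

definition tauberian_plus :: "(real \<Rightarrow> real) \<Rightarrow> real \<Rightarrow> ennreal" where
  "tauberian_plus w \<alpha> =
     (SUP E \<in> {E \<in> sets lebesgue. 0 < weight_of w E \<and> weight_of w E < \<infinity>}.
        weight_of w {x. maximal_forward (indicator E) x > ennreal \<alpha>} / weight_of w E)"

end

theory Submission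
  imports Defs
begin

text \<open>
  Write \<open>M\<close> for the backward maximal function of \<open>w 1\<^bsub>I\<^esub>\<close>, where \<open>I = (a, b)\<close>, and \<open>W\<close> for a
  primitive of \<open>w\<close>.  A point \<open>x\<close> of \<open>I\<close> satisfies \<open>M x > l\<close> exactly if the function
  \<open>t \<mapsto> W t - l t\<close> takes, to the left of \<open>x\<close>, a value below its value at \<open>x\<close>.  Hence the rising
  sun lemma describes the components \<open>(c, d)\<close> of \<open>{M > l}\<close>: \<open>w(c, x) \<ge> l (x - c)\<close> for all \<open>x\<close> in
  \<open>(c, d)\<close>, and \<open>w(c, d) = l (d - c)\<close> unless \<open>d = b\<close>.  In the same way, if \<open>(c, d)\<close> is a component
  of the set where the forward maximal function of \<open>1\<^bsub>E\<^esub>\<close> exceeds \<open>\<alpha>\<close>, then \<open>E\<close> fills at least the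
  fraction \<open>\<alpha>\<close> of \<open>(x, d)\<close> for every \<open>x\<close> in \<open>(c, d)\<close>.  All global estimates are sums of
  estimates over components (lemma \<open>nn_integral_mono_components\<close>).

  (iii) implies (i).  Let \<open>K\<close> bound the tauberian constant at level \<open>\<alpha>\<close>, and let \<open>(c, d)\<close> be a
  component of \<open>{M > l}\<close>.  Its left half carries weight at least \<open>l (d - c) / 2\<close>.  The set \<open>E\<close> of
  points of \<open>(c, d)\<close> where \<open>w\<close> is at most a small multiple of \<open>l / K\<close> has so little weight that, by
  the tauberian bound, the set where its maximal function exceeds \<open>\<alpha>\<close> cannot contain the left half.
  At a point of the left half outside this set, a fraction \<open>1 - \<alpha>\<close> of the interval up to \<open>d\<close> lies
  in the complement of \<open>E\<close>.  Thus \<open>|{M > l}|\<close> is bounded by a multiple of the unweighted measure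
  \<open>|{x \<in> I. w x > l / (5 K)}|\<close> (lemmas \<open>superlevel_density\<close> and \<open>level_measure_le\<close>), and summing
  over dyadic \<open>l\<close> bounds the integral of \<open>M\<close> by a multiple of \<open>w(I)\<close>.

  (i) implies (ii).  Let \<open>A\<close> be the constant in (i), and let \<open>l\<close> be at least as large as all
  averages of \<open>w\<close> over intervals \<open>(y, b)\<close> in \<open>I\<close>.  On a component of \<open>{M > l}\<close> the maximal function
  coincides with that of the component, so (i) gives
  \<open>\<integral>\<^bsub>{M > l}\<^esub> M \<le> A l |{M > l}|\<close>.  This makes the excess \<open>\<integral>\<^bsub>I\<^esub> (M - l)\<^sup>+\<close> shrink by a fixed factor
  \<open>\<rho> < 1\<close> whenever \<open>l\<close> doubles (lemma \<open>excess_double_le\<close>).  Since \<open>w \<le> M\<close> almost everywhere,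
  \<open>w(F) \<le> 2\<^sup>k l |F| + \<rho>\<^sup>k A w(I)\<close> for all \<open>F \<subseteq> I\<close> and all \<open>k\<close>: this quantitative absolute continuity
  takes the place of a reverse Hoelder inequality.  It is applied to the complement of \<open>E\<close> in a
  component \<open>(c, d)\<close> of the superlevel set of the maximal function of \<open>1\<^bsub>E\<^esub>\<close>, on slices whose lengths
  decrease geometrically towards \<open>d\<close>, and shows that this complement carries at most a fraction
  \<open>\<eta>\<close> of the weight of the component (lemma \<open>weight_thin_le\<close>), where \<open>\<eta>\<close> is a power of \<open>1 - \<alpha>\<close>
  for the best \<open>k\<close>.  Therefore the superlevel set has weight at most \<open>w(E) / (1 - \<eta>)\<close>.

  (ii) implies (iii) because the estimate in (ii) has a finite right-hand side.
\<close>

section \<open>Primitives and one-sided maximal functions\<close>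

text \<open>All one-sided averages of \<open>\<bar>f\<bar>\<close> are difference quotients of such a \<open>W\<close>, so statements on
  maximal functions become statements on the graph of one continuous real function.\<close>

definition primitive :: "(real \<Rightarrow> real) \<Rightarrow> (real \<Rightarrow> real) \<Rightarrow> bool" where
  "primitive W f \<longleftrightarrow> continuous_on UNIV W \<and> mono W \<and>
     (\<forall>x y. x \<le> y \<longrightarrow> (\<integral>\<^sup>+ t \<in> {x..y}. ennreal \<bar>f t\<bar> \<partial>lebesgue) = ennreal (W y - W x))"

lemma primitiveD:
  assumes "primitive W f"
  shows "continuous_on S W" "mono W" "x \<le> y \<Longrightarrow> W x \<le> W y"
    and "x \<le> y \<Longrightarrow> (\<integral>\<^sup>+ t \<in> {x..y}. ennreal \<bar>f t\<bar> \<partial>lebesgue) = ennreal (W y - W x)"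
  using assms continuous_on_subset[of UNIV W S] unfolding primitive_def by (auto dest: monoD)

lemma primitive_exists:
  assumes "locally_integrable f"
  obtains W where "primitive W f"
proof -
  define g where "g = (\<lambda>t. \<bar>f t\<bar>)"
  have abs_g: "g absolutely_integrable_on {x..y}" for x y
    using assms unfolding locally_integrable_def g_def
    by (auto intro!: set_integrable_abs)
  then have int_g: "g integrable_on {x..y}" for x y
    using set_lebesgue_integral_eq_integral(1) by blast
  define W where "W t = integral {0..t} g - integral {t..0} g" for t
  have W_diff: "W y - W x = integral {x..y} g" if "x \<le> y" for x y
  proof -
    have *: "integral {a..b} g + integral {b..c} g = integral {a..c} g" if "a \<le> b" "b \<le> c" for a b c
      using that int_g by (intro Henstock_Kurzweil_Integration.integral_combine) auto
    consider "0 \<le> x" | "x \<le> 0" "0 \<le> y" | "y \<le> 0" by linarith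
    then show ?thesis
      using that *[of 0 x y] *[of x 0 y] *[of x y 0] unfolding W_def
      by cases (auto simp: le_less)
  qed
  have "isCont W t" for t
  proof -
    have "continuous_on {t-1..t+1} (\<lambda>s. W (t-1) + integral {t-1..s} g)"
      by (intro continuous_intros indefinite_integral_continuous_1 int_g)
    then have "continuous_on {t-1..t+1} W"
      by (rule continuous_on_eq) (simp flip: W_diff)
    then show ?thesis
      by (rule continuous_on_interior) auto
  qed
  moreover have "mono W"
  proof (rule monoI)
    fix x y :: real assume "x \<le> y"
    moreover have "integral {x..y} g \<ge> 0"
      by (rule integral_nonneg[OF int_g]) (auto simp: g_def)
    ultimately show "W x \<le> W y" using W_diff by fastforce
  qed
  moreover have "(\<integral>\<^sup>+ t \<in> {x..y}. ennreal \<bar>f t\<bar> \<partial>lebesgue) = ennreal (W y - W x)" if "x \<le> y" for x y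
  proof -
    have "(\<integral>\<^sup>+ t. ennreal (indicator {x..y} t *\<^sub>R g t) \<partial>lebesgue)
        = ennreal (LINT t:{x..y}|lebesgue. g t)"
      unfolding set_lebesgue_integral_def
      by (rule nn_integral_eq_integral)
         (use abs_g[of x y] in \<open>auto simp: set_integrable_def g_def\<close>)
    also have "(LINT t:{x..y}|lebesgue. g t) = W y - W x"
      using set_lebesgue_integral_eq_integral(2)[OF abs_g] W_diff[OF that] by simp
    finally show ?thesis
      by (simp add: g_def nn_integral_set_ennreal mult.commute)
  qed
  ultimately show ?thesis
    by (intro that[of W]) (auto simp: primitive_def continuous_on_eq_continuous_within)
qed

lemma locally_integrable_indicator:
  assumes "E \<in> sets lebesgue"
  shows "locally_integrable (indicator E)"
  unfolding locally_integrable_def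
proof safe
  fix K :: "real set" assume "compact K"
  then have K: "K \<in> lmeasurable" by (rule lmeasurable_compact)
  have "integrable lebesgue (indicator (K \<inter> E) :: real \<Rightarrow> real)"
    using fmeasurable_Int_fmeasurable[OF K assms]
    by (intro integrable_real_indicator) (auto simp: fmeasurable_def)
  then show "(indicator E :: real \<Rightarrow> real) absolutely_integrable_on K"
    by (simp add: set_integrable_def flip: indicator_inter_arith)
qed

lemma primitive_indicator:
  assumes V: "primitive V (indicator E)" and E: "E \<in> sets lebesgue" and xy: "x \<le> y"
  shows "emeasure lebesgue (E \<inter> {x..y}) = ennreal (V y - V x)"
proof -
  have "emeasure lebesgue (E \<inter> {x..y}) = (\<integral>\<^sup>+ t \<in> {x..y}. ennreal \<bar>indicator E t\<bar> \<partial>lebesgue)"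
    using E by (subst nn_integral_indicator[symmetric])
      (auto intro!: nn_integral_cong simp: indicator_def)
  then show ?thesis using primitiveD(4)[OF V xy] by simp
qed

lemma maximal_forward_gt_iff:
  assumes W: "primitive W f" and "0 \<le> l"
  shows "ennreal l < maximal_forward f x \<longleftrightarrow> (\<exists>y>x. l * (y - x) < W y - W x)"
proof -
  have "ennreal l < (\<integral>\<^sup>+ t \<in> {x..x + h}. ennreal \<bar>f t\<bar> \<partial>lebesgue) / ennreal h
      \<longleftrightarrow> l * ((x + h) - x) < W (x + h) - W x" if "0 < h" for h
    using that \<open>0 \<le> l\<close> primitiveD(3,4)[OF W, of x "x+h"]
    by (simp add: divide_ennreal ennreal_less_iff pos_less_divide_eq)
  then have "ennreal l < maximal_forward f x \<longleftrightarrow> (\<exists>h>0. l * ((x + h) - x) < W (x + h) - W x)"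
    unfolding maximal_forward_def less_SUP_iff by auto
  also have "\<dots> \<longleftrightarrow> (\<exists>y>x. l * (y - x) < W y - W x)"
    by (metis add.commute add_diff_cancel diff_add_cancel diff_gt_0_iff_gt)
  finally show ?thesis .
qed

lemma maximal_backward_gt_iff:
  assumes W: "primitive W f" and "0 \<le> l"
  shows "ennreal l < maximal_backward f x \<longleftrightarrow> (\<exists>y<x. l * (x - y) < W x - W y)"
proof -
  have "ennreal l < (\<integral>\<^sup>+ t \<in> {x - h..x}. ennreal \<bar>f t\<bar> \<partial>lebesgue) / ennreal h
      \<longleftrightarrow> l * (x - (x - h)) < W x - W (x - h)" if "0 < h" for h
    using that \<open>0 \<le> l\<close> primitiveD(3,4)[OF W, of "x-h" x]
    by (simp add: divide_ennreal ennreal_less_iff pos_less_divide_eq)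
  then have "ennreal l < maximal_backward f x \<longleftrightarrow> (\<exists>h>0. l * (x - (x - h)) < W x - W (x - h))"
    unfolding maximal_backward_def less_SUP_iff by auto
  also have "\<dots> \<longleftrightarrow> (\<exists>y<x. l * (x - y) < W x - W y)"
    by (metis diff_diff_eq2 add_diff_cancel_left' diff_gt_0_iff_gt)
  finally show ?thesis .
qed

text \<open>The averages over \<open>(x, y)\<close> depend continuously on \<open>x\<close>, so a supremum of them over \<open>y\<close> is lower
  semicontinuous.\<close>

lemma open_maximal_forward_gt:
  assumes W: "primitive W f" and "0 \<le> l"
  shows "open {x. ennreal l < maximal_forward f x}"
proof -
  have "{x. ennreal l < maximal_forward f x} = (\<Union>y. {x. x < y \<and> l * (y - x) < W y - W x})"
    using maximal_forward_gt_iff[OF assms] by auto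
  also have "open \<dots>"
    by (intro open_UN ballI open_Collect_conj open_Collect_less continuous_intros primitiveD(1)[OF W])
  finally show ?thesis .
qed

lemma open_maximal_backward_gt:
  assumes W: "primitive W f" and "0 \<le> l"
  shows "open {x. ennreal l < maximal_backward f x}"
proof -
  have "{x. ennreal l < maximal_backward f x} = (\<Union>y. {x. y < x \<and> l * (x - y) < W x - W y})"
    using maximal_backward_gt_iff[OF assms] by auto
  also have "open \<dots>"
    by (intro open_UN ballI open_Collect_conj open_Collect_less continuous_intros primitiveD(1)[OF W])
  finally show ?thesis .
qed

lemma measurable_maximal_backward:
  assumes W: "primitive W f"
  shows "maximal_backward f \<in> borel_measurable lebesgue"
proof (rule borel_measurableI_greater)
  fix y :: ennreal
  show "{x \<in> space lebesgue. y < maximal_backward f x} \<in> sets lebesgue"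
  proof (cases y)
    case (real r)
    then show ?thesis
      using open_maximal_backward_gt[OF W, of r] by (auto intro: borel_open)
  qed auto
qed

lemma locally_integrable_borel_measurable:
  assumes "locally_integrable f"
  shows "f \<in> borel_measurable lebesgue"
proof (rule borel_measurable_LIMSEQ_metric)
  fix n :: nat
  have "f absolutely_integrable_on {- real n..real n}"
    using assms by (simp add: locally_integrable_def)
  then show "(\<lambda>x. indicator {- real n..real n} x *\<^sub>R f x) \<in> borel_measurable lebesgue"
    by (simp add: set_integrable_def)
next
  fix x :: real
  obtain N :: nat where N: "\<bar>x\<bar> \<le> real N" using real_arch_simple by blast
  have "indicator {- real n..real n} x *\<^sub>R f x = f x" if "N \<le> n" for n
    using N that by (auto simp: indicator_def)
  then show "(\<lambda>n. indicator {- real n..real n} x *\<^sub>R f x) \<longlonglongrightarrow> f x"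
    by (intro tendsto_eventually) (auto simp: eventually_sequentially)
qed

lemma AE_lebesgue_neq: "AE x in lebesgue. x \<noteq> (c :: real)"
  by (intro AE_completion AE_lborel_singleton)

text \<open>Lebesgue's differentiation theorem for intervals to the right of a point, applied to the
  reflection of \<open>\<bar>f\<bar>\<close> at the origin.\<close>

lemma AE_maximal_backward_ge:
  assumes f: "locally_integrable f"
  shows "AE x in lebesgue. ennreal \<bar>f x\<bar> \<le> maximal_backward f x"
proof -
  obtain W where W: "primitive W f" using primitive_exists[OF f] .
  define g where "g = (\<lambda>t. \<bar>f (- t)\<bar>)"
  have abs_f: "(\<lambda>t. \<bar>f t\<bar>) absolutely_integrable_on {x..y}" for x y
    using f unfolding locally_integrable_def by (auto intro!: set_integrable_abs)
  then have int_f: "(\<lambda>t. \<bar>f t\<bar>) integrable_on {x..y}" for x y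
    using set_lebesgue_integral_eq_integral(1) by blast
  have int_g: "g integrable_on cbox x y" for x y
    using int_f[of "-y" "-x"] 
      Henstock_Kurzweil_Integration.integrable_reflect_real[where f = "\<lambda>t. \<bar>f t\<bar>" and a = "- y" and b = "- x"]
    by (simp add: g_def)
  have W_int: "integral {x..y} (\<lambda>t. \<bar>f t\<bar>) = W y - W x" if "x \<le> y" for x y
  proof -
    have "ennreal (LINT t:{x..y}|lebesgue. \<bar>f t\<bar>) = (\<integral>\<^sup>+ t. ennreal (indicator {x..y} t *\<^sub>R \<bar>f t\<bar>) \<partial>lebesgue)"
      unfolding set_lebesgue_integral_def
      by (rule nn_integral_eq_integral[symmetric])
         (use abs_f[of x y] in \<open>auto simp: set_integrable_def\<close>)
    also have "\<dots> = ennreal (W y - W x)"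
      using primitiveD(4)[OF W that] by (simp add: nn_integral_set_ennreal mult.commute)
    finally have "ennreal (integral {x..y} (\<lambda>t. \<bar>f t\<bar>)) = ennreal (W y - W x)"
      using set_lebesgue_integral_eq_integral(2)[OF abs_f] by simp
    then show ?thesis
      using primitiveD(3)[OF W that] integral_nonneg[OF int_f[of x y]] by simp
  qed
  obtain N where N: "negligible N" and
    lim: "\<And>x e. x \<notin> N \<Longrightarrow> 0 < e \<Longrightarrow> \<exists>d>0. \<forall>h. 0 < h \<and> h < d \<longrightarrow>
       norm (integral (cbox x (x + h *\<^sub>R One)) g /\<^sub>R h ^ DIM(real) - g x) < e"
    using integrable_ccontinuous_explicit[OF int_g] by blast
  have "negligible (uminus ` N)"
    by (intro negligible_differentiable_image_negligible N) (auto intro!: derivative_intros)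
  then have "AE x in lebesgue. x \<notin> uminus ` N"
    by (simp add: negligible_iff_null_sets AE_not_in)
  then show ?thesis
  proof eventually_elim
    case (elim x)
    then have x: "- x \<notin> N" by force
    show ?case
    proof (rule dense_le)
      fix y assume "y < ennreal \<bar>f x\<bar>"
      then obtain r where r: "y = ennreal r" "0 \<le> r" "r < \<bar>f x\<bar>"
        by (cases y) (auto simp: ennreal_less_iff)
      from lim[OF x, of "\<bar>f x\<bar> - r"] r obtain d where d: "d > 0"
        "\<And>h. 0 < h \<Longrightarrow> h < d \<Longrightarrow> \<bar>integral {- x..- x + h} g / h - \<bar>f x\<bar>\<bar> < \<bar>f x\<bar> - r"
        by (auto simp: g_def divide_inverse mult.commute)
      define h where "h = d / 2"
      have h: "0 < h" "h < d" using d(1) by (auto simp: h_def)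
      have "integral {- x..- x + h} g = W x - W (x - h)"
        using h W_int[of "x - h" x] Henstock_Kurzweil_Integration.integral_reflect_real
          [of "x" "x-h" "\<lambda>t. \<bar>f t\<bar>"]
        by (simp add: g_def add.commute)
      then have "\<bar>(W x - W (x - h)) / h - \<bar>f x\<bar>\<bar> < \<bar>f x\<bar> - r"
        using d(2)[OF h] by simp
      then have "r < (W x - W (x - h)) / h" by linarith
      then have "r * (x - (x - h)) < W x - W (x - h)"
        using h by (simp add: pos_less_divide_eq)
      then have "ennreal r < maximal_backward f x"
        unfolding maximal_backward_gt_iff[OF W r(2)] using h by (intro exI[of _ "x - h"]) auto
      then show "y \<le> maximal_backward f x" using r by auto
    qed
  qed
qed

section \<open>The rising sun lemma and components of open sets\<close>

text \<open>A minimum point of \<open>\<phi>\<close> on \<open>[c, x]\<close> other than \<open>c\<close> would have a still smaller value of \<open>\<phi>\<close> somewhere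
  to its left, necessarily to the left of \<open>c\<close>, contrary to the assumption on \<open>c\<close>.\<close>

lemma rising_sun_left:
  fixes \<phi> :: "real \<Rightarrow> real"
  assumes cont: "continuous_on UNIV \<phi>"
    and U: "\<And>x. x \<in> {c<..<d} \<Longrightarrow> \<exists>y<x. \<phi> y < \<phi> x"
    and c: "\<not> (\<exists>y<c. \<phi> y < \<phi> c)"
    and x: "x \<in> {c<..<d}"
  shows "\<phi> c \<le> \<phi> x"
proof (rule ccontr)
  assume less: "\<not> \<phi> c \<le> \<phi> x"
  have "compact {c..x}" "{c..x} \<noteq> {}" "continuous_on {c..x} \<phi>"
    using x cont continuous_on_subset by auto
  then obtain z where z: "z \<in> {c..x}" "\<And>y. y \<in> {c..x} \<Longrightarrow> \<phi> z \<le> \<phi> y"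
    using continuous_attains_inf by metis
  have "\<phi> z \<le> \<phi> x" using z(2)[of x] x by auto
  with less z have "z \<noteq> c" by auto
  with z x have "z \<in> {c<..<d}" by auto
  from U[OF this] obtain y where y: "y < z" "\<phi> y < \<phi> z" by blast
  have "y < c" using z(2)[of y] y z(1) by force
  moreover have "\<phi> y < \<phi> c" using y \<open>\<phi> z \<le> \<phi> x\<close> less by linarith
  ultimately show False using c by blast
qed

lemma rising_sun_right:
  fixes \<psi> :: "real \<Rightarrow> real"
  assumes cont: "continuous_on UNIV \<psi>"
    and U: "\<And>x. x \<in> {c<..<d} \<Longrightarrow> \<exists>y>x. \<psi> x < \<psi> y"
    and d: "\<not> (\<exists>y>d. \<psi> d < \<psi> y)"
    and x: "x \<in> {c<..<d}"
  shows "\<psi> x \<le> \<psi> d"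
proof -
  have "- \<psi> (- (- d)) \<le> - \<psi> (- (- x))"
  proof (rule rising_sun_left[where \<phi> = "\<lambda>t. - \<psi> (- t)" and c = "-d" and d = "-c"])
    show "continuous_on UNIV (\<lambda>t. - \<psi> (- t))"
      by (intro continuous_intros continuous_on_compose2[OF cont]) auto
    show "\<exists>z<y. - \<psi> (- z) < - \<psi> (- y)" if "y \<in> {- d<..<- c}" for y
    proof -
      have "- y \<in> {c<..<d}" using that by auto
      from U[OF this] obtain z where "z > - y" "\<psi> (- y) < \<psi> z" by blast
      then show ?thesis by (intro exI[of _ "- z"]) auto
    qed
    show "\<not> (\<exists>y< - d. - \<psi> (- y) < - \<psi> (- (- d)))"
    proof
      assume "\<exists>y< - d. - \<psi> (- y) < - \<psi> (- (- d))"
      then obtain y where "y < - d" "\<psi> d < \<psi> (- y)" by auto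
      then show False using d by (auto dest: spec[of _ "- y"])
    qed
  qed (use x in auto)
  then show ?thesis by simp
qed

lemma component_of_bounded_open_real:
  fixes V :: "real set"
  assumes "open V" "bounded V" "C \<in> components V"
  obtains c d where "c < d" "C = {c<..<d}" "C \<subseteq> V" "c \<notin> V" "d \<notin> V"
proof -
  have C: "C \<noteq> {}" "C \<subseteq> V" "connected C" "open C"
    and max: "\<And>D. C \<subseteq> D \<Longrightarrow> D \<subseteq> V \<Longrightarrow> connected D \<Longrightarrow> D = C"
    using assms(3) open_components[OF assms(1,3)] by (simp_all add: in_components_maximal)
      (metis bot.extremum_uniqueI)
  have bd: "bdd_below C" "bdd_above C"
    using bounded_subset[OF assms(2) C(2)]
    by (auto intro: bounded_imp_bdd_below bounded_imp_bdd_above)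
  define c d where "c = Inf C" and "d = Sup C"
  have eq: "C = {c<..<d}"
  proof (intro equalityI subsetI)
    fix x assume "x \<in> C"
    then obtain e where e: "e > 0" "cball x e \<subseteq> C"
      using C(4) open_contains_cball by blast
    then have "x - e \<in> C" "x + e \<in> C" by (auto simp: subset_iff dist_real_def)
    then have "c \<le> x - e" "x + e \<le> d"
      using bd by (auto simp: c_def d_def intro: cInf_lower cSup_upper)
    then show "x \<in> {c<..<d}" using e by auto
  next
    fix x assume "x \<in> {c<..<d}"
    then obtain u v where "u \<in> C" "u < x" "v \<in> C" "x < v"
      using bd C(1) by (auto simp: c_def d_def cInf_less_iff less_cSup_iff)
    then show "x \<in> C" using C(3) connectedD_interval[of C u v x] by auto
  qed
  then have cd: "c < d" using C(1) by auto
  have "c \<notin> V"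
  proof
    assume "c \<in> V"
    then have "{c..<d} \<subseteq> V" using C(2) eq by (auto simp: subset_iff le_less)
    then have "{c..<d} = C" using eq by (intro max) auto
    then show False using eq cd by auto
  qed
  moreover have "d \<notin> V"
  proof
    assume "d \<in> V"
    then have "{c<..d} \<subseteq> V" using C(2) eq by (auto simp: subset_iff le_less)
    then have "{c<..d} = C" using eq by (intro max) auto
    then show False using eq cd by auto
  qed
  ultimately show ?thesis using that cd eq C(2) by blast
qed

text \<open>A bounded open set is the disjoint union of its countably many components, which are open
  intervals whose endpoints lie outside the set.\<close>

lemma nn_integral_mono_components:
  fixes f g :: "real \<Rightarrow> ennreal"
  assumes V: "open V" "bounded V"
    and meas: "f \<in> borel_measurable lebesgue" "g \<in> borel_measurable lebesgue"
    and le: "\<And>c d. c < d \<Longrightarrow> {c<..<d} \<subseteq> V \<Longrightarrow> c \<notin> V \<Longrightarrow> d \<notin> V \<Longrightarrow>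
      (\<integral>\<^sup>+ x \<in> {c<..<d}. f x \<partial>lebesgue) \<le> (\<integral>\<^sup>+ x \<in> {c<..<d}. g x \<partial>lebesgue)"
  shows "(\<integral>\<^sup>+ x \<in> V. f x \<partial>lebesgue) \<le> (\<integral>\<^sup>+ x \<in> V. g x \<partial>lebesgue)"
proof -
  have comp_open: "open C" if "C \<in> components V" for C
    using that V open_components by blast
  then have sets: "C \<in> sets lebesgue" if "C \<in> components V" for C
    using that by (auto intro: borel_open)
  have disj: "disjoint (components V)"
    using pairwise_disjoint_components[of V] by (simp add: disjoint_def pairwise_def disjnt_def)
  have count: "countable (components V)"
    using comp_open disj by (intro countable_disjoint_open_subsets) (auto simp: disjoint_def pairwise_def disjnt_def)
  have split: "(\<integral>\<^sup>+ x \<in> V. h x \<partial>lebesgue)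
      = (\<integral>\<^sup>+ C. (\<integral>\<^sup>+ x \<in> C. h x \<partial>lebesgue) \<partial>count_space (components V))"
    if h: "h \<in> borel_measurable lebesgue" for h :: "real \<Rightarrow> ennreal"
  proof -
    have "(\<integral>\<^sup>+ x \<in> V. h x \<partial>lebesgue) = emeasure (density lebesgue h) (\<Union>C\<in>components V. C)"
      using h V(1) by (simp add: emeasure_density borel_open)
    also have "\<dots> = (\<integral>\<^sup>+ C. emeasure (density lebesgue h) C \<partial>count_space (components V))"
      using sets count disj
      by (intro emeasure_UN_countable) (auto simp: disjoint_def disjoint_family_on_def)
    also have "\<dots> = (\<integral>\<^sup>+ C. (\<integral>\<^sup>+ x \<in> C. h x \<partial>lebesgue) \<partial>count_space (components V))"
      using sets h by (intro nn_integral_cong) (simp add: emeasure_density)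
    finally show ?thesis .
  qed
  show ?thesis
    unfolding split[OF meas(1)] split[OF meas(2)]
  proof (rule nn_integral_mono)
    fix C assume "C \<in> space (count_space (components V))"
    then obtain c d where "c < d" "C = {c<..<d}" "C \<subseteq> V" "c \<notin> V" "d \<notin> V"
      using component_of_bounded_open_real[OF V, of C] by auto
    then show "(\<integral>\<^sup>+ x \<in> C. f x \<partial>lebesgue) \<le> (\<integral>\<^sup>+ x \<in> C. g x \<partial>lebesgue)"
      using le by auto
  qed
qed

section \<open>Level sets of the truncated maximal function of a weight\<close>

text \<open>A weight together with a primitive.  Every weight of the theorem has one, so fixing it costs no
  generality.\<close>

locale weight =
  fixes w W :: "real \<Rightarrow> real"
  assumes nonneg: "0 \<le> w x"
    and loc_int: "locally_integrable w"
    and prim: "primitive W w"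
begin

lemma measurable_w [measurable]: "w \<in> borel_measurable lebesgue"
  using loc_int by (rule locally_integrable_borel_measurable)

lemma measurable_ennreal_w: "(\<lambda>x. ennreal (w x)) \<in> borel_measurable lebesgue"
  by (rule measurable_compose[OF measurable_w measurable_ennreal])

lemma sets_w_superlevel [measurable]:
  "{x. q < w x} \<in> sets lebesgue"
  "{x \<in> {a<..<b}. q < w x} \<in> sets lebesgue"
  "{x \<in> {a<..<b}. w x \<le> q} \<in> sets lebesgue"
proof -
  show *: "{x. q < w x} \<in> sets lebesgue"
    using measurable_sets[OF measurable_w, of "{q<..}"] by (simp add: vimage_def)
  have "{x \<in> {a<..<b}. q < w x} = {a<..<b} \<inter> {x. q < w x}"
    "{x \<in> {a<..<b}. w x \<le> q} = {a<..<b} - {x. q < w x}" by auto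
  moreover have "{a<..<b} \<in> sets lebesgue" by simp
  ultimately show "{x \<in> {a<..<b}. q < w x} \<in> sets lebesgue"
    "{x \<in> {a<..<b}. w x \<le> q} \<in> sets lebesgue"
    using * sets.Int sets.Diff by metis+
qed

lemma W_mono: "x \<le> y \<Longrightarrow> W x \<le> W y"
  using primitiveD(3)[OF prim] .

lemma W_cont: "continuous_on S W"
  using primitiveD(1)[OF prim] .

abbreviation \<mu> where "\<mu> \<equiv> density lebesgue (\<lambda>t. ennreal (w t))"

lemma weight_eq: "E \<in> sets lebesgue \<Longrightarrow> weight_of w E = emeasure \<mu> E"
  by (simp add: weight_of_def emeasure_density)

lemma weight_mono: "A \<subseteq> B \<Longrightarrow> weight_of w A \<le> weight_of w B"
  unfolding weight_of_def by (intro nn_integral_mono) (auto simp: indicator_def)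

lemma weight_Icc: "x \<le> y \<Longrightarrow> weight_of w {x..y} = ennreal (W y - W x)"
  using primitiveD(4)[OF prim] nonneg by (simp add: weight_of_def)

lemma weight_Ioo: "x \<le> y \<Longrightarrow> weight_of w {x<..<y} = ennreal (W y - W x)"
proof (subst weight_Icc[symmetric], assumption, unfold weight_of_def, rule nn_integral_cong_AE)
  show "AE t in lebesgue. ennreal (w t) * indicator {x<..<y} t = ennreal (w t) * indicator {x..y} t"
    using AE_lebesgue_neq[of x] AE_lebesgue_neq[of y]
    by eventually_elim (auto simp: indicator_def)
qed

abbreviation trunc :: "real \<Rightarrow> real \<Rightarrow> real \<Rightarrow> real" where
  "trunc a b \<equiv> (\<lambda>t. w t * indicator {a<..<b} t)"

abbreviation Wtrunc :: "real \<Rightarrow> real \<Rightarrow> real \<Rightarrow> real" where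
  "Wtrunc a b \<equiv> (\<lambda>t. W (max a (min b t)))"

text \<open>The truncated weight has the primitive that is constant outside \<open>[a, b]\<close> and equal to \<open>W\<close> inside.\<close>

lemma primitive_trunc:
  assumes "a < b"
  shows "primitive (Wtrunc a b) (trunc a b)"
  unfolding primitive_def
proof (intro conjI allI impI)
  show "continuous_on UNIV (Wtrunc a b)"
    by (rule continuous_on_compose2[OF W_cont[of UNIV]]) (auto intro!: continuous_intros)
  show "mono (Wtrunc a b)"
    by (intro monoI W_mono) auto
next
  fix x y :: real assume "x \<le> y"
  define x' y' where "x' = max a (min b x)" and "y' = max a (min b y)"
  have le: "x' \<le> y'" using \<open>x \<le> y\<close> by (auto simp: x'_def y'_def)
  have "(\<integral>\<^sup>+ t \<in> {x..y}. ennreal \<bar>trunc a b t\<bar> \<partial>lebesgue)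
      = (\<integral>\<^sup>+ t \<in> {x'..y'}. ennreal (w t) \<partial>lebesgue)"
  proof (rule nn_integral_cong_AE)
    show "AE t in lebesgue. ennreal \<bar>trunc a b t\<bar> * indicator {x..y} t
        = ennreal (w t) * indicator {x'..y'} t"
      using AE_lebesgue_neq[of a] AE_lebesgue_neq[of b]
      by eventually_elim
        (use assms nonneg in \<open>auto simp: indicator_def x'_def y'_def max_def min_def split: if_splits\<close>)
  qed
  also have "\<dots> = ennreal (W y' - W x')"
    using weight_Icc[OF le] by (simp add: weight_of_def)
  finally show "(\<integral>\<^sup>+ t \<in> {x..y}. ennreal \<bar>trunc a b t\<bar> \<partial>lebesgue)
      = ennreal (Wtrunc a b y - Wtrunc a b x)"
    by (simp add: x'_def y'_def)
qed

abbreviation M :: "real \<Rightarrow> real \<Rightarrow> real \<Rightarrow> ennreal" where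
  "M a b \<equiv> maximal_backward (trunc a b)"

lemma measurable_M: "a < b \<Longrightarrow> M a b \<in> borel_measurable lebesgue"
  using measurable_maximal_backward primitive_trunc by blast

definition level :: "real \<Rightarrow> real \<Rightarrow> real \<Rightarrow> real set" where
  "level a b l = {x \<in> {a<..<b}. ennreal l < M a b x}"

text \<open>Averages over intervals that start to the left of \<open>a\<close> are included here; they are harmless since
  \<open>Wtrunc\<close> is constant on that side.\<close>

lemma M_gt_iff:
  assumes "a < b" "0 \<le> l"
  shows "ennreal l < M a b x \<longleftrightarrow> (\<exists>y<x. Wtrunc a b y - l * y < Wtrunc a b x - l * x)"
  unfolding maximal_backward_gt_iff[OF primitive_trunc[OF assms(1)] assms(2)]
  by (simp add: algebra_simps)

lemma level_open:
  assumes "a < b" "0 \<le> l"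
  shows "open (level a b l)" "bounded (level a b l)"
proof -
  have "level a b l = {a<..<b} \<inter> {x. ennreal l < M a b x}" by (auto simp: level_def)
  then show "open (level a b l)"
    using open_maximal_backward_gt[OF primitive_trunc[OF assms(1)] assms(2)] by auto
  show "bounded (level a b l)"
    by (rule bounded_subset[of "{a..b}"]) (auto simp: level_def)
qed

text \<open>The rising sun lemma for the level sets.  The left endpoint \<open>c\<close> is never a point with large
  averages: either \<open>c\<close> lies in \<open>(a, b)\<close> outside the level set, or \<open>c = a\<close>, where all averages
  vanish.  At the right endpoint the same holds only for \<open>d < b\<close>, because a component may be cut off
  by \<open>b\<close>.\<close>

lemma level_component:
  assumes ab: "a < b" "0 \<le> l" and cd: "c < d"
    and V: "{c<..<d} \<subseteq> level a b l" "c \<notin> level a b l" "d \<notin> level a b l"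
  shows "a \<le> c" "d \<le> b"
    and "\<And>y. y < c \<Longrightarrow> W c - Wtrunc a b y \<le> l * (c - y)"
    and "\<And>x. x \<in> {c<..<d} \<Longrightarrow> l * (x - c) \<le> W x - W c"
    and "d < b \<Longrightarrow> W d - W c \<le> l * (d - c)"
proof -
  have "{c<..<d} \<subseteq> {a<..<b}" using V(1) by (auto simp: level_def)
  then show ac: "a \<le> c" and db: "d \<le> b"
    using cd greaterThanLessThan_subseteq_greaterThanLessThan by (metis)+
  have Wc: "Wtrunc a b t = W t" if "c \<le> t" "t \<le> d" for t
  proof -
    have "max a (min b t) = t" using that ac db by linarith
    then show ?thesis by simp
  qed
  have c: "\<not> (\<exists>y<c. Wtrunc a b y - l * y < Wtrunc a b c - l * c)"
  proof (cases "c = a")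
    case True
    have "Wtrunc a b y - l * y \<ge> Wtrunc a b c - l * c" if "y < c" for y
      using that True ab mult_left_mono[of y c l] by (simp add: max_def min_def)
    then show ?thesis by (meson not_less)
  next
    case False
    then have "c \<in> {a<..<b}" using ac db cd by auto
    then show ?thesis using V(2) M_gt_iff[OF ab] by (auto simp: level_def)
  qed
  show "W c - Wtrunc a b y \<le> l * (c - y)" if "y < c" for y
  proof -
    have "\<not> (Wtrunc a b y - l * y < Wtrunc a b c - l * c)"
      using c that by blast
    then show ?thesis using Wc[of c] cd by (simp add: algebra_simps)
  qed
  show "l * (x - c) \<le> W x - W c" if "x \<in> {c<..<d}" for x
  proof -
    have "Wtrunc a b c - l * c \<le> Wtrunc a b x - l * x"
    proof (rule rising_sun_left[where \<phi> = "\<lambda>t. Wtrunc a b t - l * t"])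
      show "continuous_on UNIV (\<lambda>t. Wtrunc a b t - l * t)"
        by (intro continuous_intros primitiveD(1)[OF primitive_trunc[OF ab(1)]])
      show "\<exists>y<t. Wtrunc a b y - l * y < Wtrunc a b t - l * t" if "t \<in> {c<..<d}" for t
        using V(1) that M_gt_iff[OF ab] by (auto simp: level_def)
    qed (use c that in auto)
    then show ?thesis using Wc[of c] Wc[of x] that by (simp add: algebra_simps)
  qed
  show "W d - W c \<le> l * (d - c)" if "d < b"
  proof -
    have "d \<in> {a<..<b}" using that ac cd by auto
    then have "\<not> (\<exists>y<d. Wtrunc a b y - l * y < Wtrunc a b d - l * d)"
      using V(3) M_gt_iff[OF ab] by (auto simp: level_def)
    then have "\<not> (Wtrunc a b c - l * c < Wtrunc a b d - l * d)" using cd by blast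
    then show ?thesis using Wc[of c] Wc[of d] cd by (simp add: algebra_simps)
  qed
qed

text \<open>Averages that start to the left of the component do not matter inside it: the part to the left of
  \<open>c\<close> has average at most \<open>l\<close>, while the part to the right of \<open>c\<close> has average at least \<open>l\<close>.\<close>

lemma M_localize:
  assumes ab: "a < b" "0 \<le> l" and cd: "c < d"
    and V: "{c<..<d} \<subseteq> level a b l" "c \<notin> level a b l" "d \<notin> level a b l"
    and x: "x \<in> {c<..<d}"
  shows "M a b x \<le> M c d x"
proof (rule dense_le)
  note comp = level_component[OF ab cd V]
  fix z assume z: "z < M a b x"
  then obtain r where r: "z = ennreal r" "0 \<le> r" by (cases z) auto
  from z r obtain y where y: "y < x" "Wtrunc a b y - r * y < Wtrunc a b x - r * x"
    using M_gt_iff[OF ab(1) r(2)] by auto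
  have eq: "Wtrunc a b t = W t" "Wtrunc c d t = W t" if "c \<le> t" "t < d" for t
    using that comp(1,2) by (simp_all add: max_def min_def)
  have "\<exists>y'<x. Wtrunc c d y' - r * y' < Wtrunc c d x - r * x"
  proof (cases "c \<le> y")
    case True
    then show ?thesis using y x eq[of y] eq[of x] by (intro exI[of _ y]) auto
  next
    case False
    have Wx: "l * (x - c) \<le> W x - W c" using comp(4) x by auto
    have Wy: "W c - Wtrunc a b y \<le> l * (c - y)" using comp(3) False by auto
    have "r * (x - c) < W x - W c"
    proof (cases "r < l")
      case True
      then have "r * (x - c) < l * (x - c)" using x by (intro mult_strict_right_mono) auto
      then show ?thesis using Wx by simp
    next
      case rl: False
      then have "l * (c - y) \<le> r * (c - y)" using False by (intro mult_right_mono) auto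
      then show ?thesis using y Wy eq[of x] x by (simp add: algebra_simps)
    qed
    then show ?thesis using x eq[of c] eq[of x] cd by (intro exI[of _ c]) (auto simp: algebra_simps)
  qed
  then have "ennreal r < M c d x" using M_gt_iff[OF cd r(2)] by blast
  then show "z \<le> M c d x" using r by auto
qed

lemma AE_w_le_M:
  assumes "a < b"
  shows "AE x in lebesgue. x \<in> {a<..<b} \<longrightarrow> ennreal (w x) \<le> M a b x"
proof -
  have "locally_integrable (trunc a b)"
    unfolding locally_integrable_def set_integrable_def
  proof (intro allI impI)
    fix K :: "real set" assume "compact K"
    then have "integrable lebesgue (\<lambda>x. indicator K x *\<^sub>R w x)"
      using loc_int by (simp add: locally_integrable_def set_integrable_def)
    from integrable_mult_indicator[OF _ this, of "{a<..<b}"]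
    show "integrable lebesgue (\<lambda>x. indicator K x *\<^sub>R trunc a b x)"
      by (simp add: ac_simps)
  qed
  from AE_maximal_backward_ge[OF this] show ?thesis
    by eventually_elim (use nonneg in auto)
qed

end

section \<open>From a tauberian bound to the Fujii-Wilson condition\<close>

text \<open>A layer-cake estimate that starts at level \<open>l\<close>: the partial sum over the levels below \<open>2\<^sup>n l\<close>
  telescopes to the minimum of \<open>x\<close> and \<open>2\<^sup>n l\<close>, or more.\<close>

lemma ennreal_le_dyadic_sum:
  fixes x :: ennreal and l :: real
  assumes "0 < l"
  shows "x \<le> ennreal l + (\<Sum>k. ennreal (2 ^ k * l) * indicator {y. ennreal (2 ^ k * l) < y} x)"
    (is "_ \<le> ?S")
proof -
  let ?t = "\<lambda>k. ennreal (2 ^ k * l) * indicator {y. ennreal (2 ^ k * l) < y} x"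
  have part: "min x (ennreal (2 ^ n * l)) \<le> ennreal l + (\<Sum>k<n. ?t k)" for n
  proof (induction n)
    case (Suc n)
    show ?case
    proof (cases "ennreal (2 ^ n * l) < x")
      case True
      have "min x (ennreal (2 ^ Suc n * l)) \<le> ennreal (2 ^ n * l) + ennreal (2 ^ n * l)"
        using assms by (simp flip: ennreal_plus add: min.coboundedI2)
      also have "\<dots> \<le> (ennreal l + (\<Sum>k<n. ?t k)) + ?t n"
      proof (rule add_mono)
        show "ennreal (2 ^ n * l) \<le> ennreal l + (\<Sum>k<n. ?t k)"
          using Suc.IH True by (simp only: min.absorb2 less_imp_le)
      qed (use True in simp)
      finally show ?thesis by (simp add: ac_simps)
    next
      case False
      then have "min x (ennreal (2 ^ Suc n * l)) \<le> min x (ennreal (2 ^ n * l))"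
        by (simp add: not_less min.absorb1)
      also have "\<dots> \<le> ennreal l + (\<Sum>k<Suc n. ?t k)"
        using Suc.IH False by simp
      finally show ?thesis .
    qed
  qed (simp add: min.coboundedI2)
  show ?thesis
  proof (rule ccontr)
    assume "\<not> x \<le> ?S"
    then have less: "?S < x" by simp
    then obtain r where r: "?S = ennreal r" "0 \<le> r" by (cases ?S) auto
    obtain n where "r / l < 2 ^ n" using real_arch_pow[of 2 "r / l"] by auto
    then have "?S < ennreal (2 ^ n * l)"
      using assms r by (simp add: pos_divide_less_eq ennreal_less_iff)
    with less have "?S < min x (ennreal (2 ^ n * l))" by simp
    also have "\<dots> \<le> ennreal l + (\<Sum>k<n. ?t k)" by (rule part)
    also have "\<dots> \<le> ?S" by (intro add_left_mono sum_le_suminf) auto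
    finally show False by simp
  qed
qed

text \<open>The levels below \<open>r\<close> form a geometric sum dominated by its last term.\<close>

lemma dyadic_sum_le:
  fixes r l :: real
  assumes "0 < l" "0 \<le> r"
  shows "(\<Sum>k. ennreal (2 ^ k * l) * indicator {y. 2 ^ k * l < y} r) \<le> ennreal (2 * r)"
proof -
  let ?t = "\<lambda>k. 2 ^ k * l * indicator {y. 2 ^ k * l < y} r"
  have part: "(\<Sum>k<n. ?t k) \<le> min (2 * r) (2 ^ n * l)" for n
  proof (induction n)
    case (Suc n)
    have "2 ^ n * l \<le> 2 ^ Suc n * l" using assms by simp
    moreover have "2 ^ Suc n * l = 2 ^ n * l + 2 ^ n * l" by simp
    moreover have "?t n = (if 2 ^ n * l < r then 2 ^ n * l else 0)" by simp
    ultimately have "(\<Sum>k<n. ?t k) + ?t n \<le> min (2 * r) (2 ^ Suc n * l)"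
      using Suc.IH by (cases "2 ^ n * l < r"; simp only: if_True if_False min.bounded_iff; linarith)
    then show ?case by simp
  qed (use assms in auto)
  have "(\<Sum>k<n. ennreal (2 ^ k * l) * indicator {y. 2 ^ k * l < y} r) \<le> ennreal (2 * r)" for n
  proof -
    have "(\<Sum>k<n. ennreal (2 ^ k * l) * indicator {y. 2 ^ k * l < y} r)
        = (\<Sum>k<n. ennreal (2 ^ k * l * indicator {y. 2 ^ k * l < y} r))"
      by (intro sum.cong refl) (simp add: indicator_def)
    also have "\<dots> = ennreal (\<Sum>k<n. 2 ^ k * l * indicator {y. 2 ^ k * l < y} r)"
      using assms by (intro sum_ennreal) auto
    also have "\<dots> \<le> ennreal (2 * r)" using part[of n] by (intro ennreal_leI) auto
    finally show ?thesis .
  qed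
  then show ?thesis by (simp add: suminf_eq_SUP SUP_le_iff)
qed

context weight
begin

text \<open>The case \<open>weight_of w {a<..<b} = 0\<close> relies on \<open>0 / 0 = 0\<close>: the bound forces the numerator to vanish.\<close>

lemma A_infty_plusI:
  assumes B: "\<And>a b. a < b \<Longrightarrow> (\<integral>\<^sup>+ x \<in> {a<..<b}. M a b x \<partial>lebesgue) \<le> ennreal B * weight_of w {a<..<b}"
  shows "A_infty_plus w"
proof -
  have "(\<integral>\<^sup>+ x \<in> {a<..<b}. M a b x \<partial>lebesgue) / weight_of w {a<..<b} \<le> ennreal B" if "a < b" for a b
  proof (cases "weight_of w {a<..<b} = 0")
    case True
    then show ?thesis using B[OF that] by simp
  next
    case False
    then show ?thesis using B[OF that]
      by (intro divide_le_posI_ennreal) (auto simp: mult.commute zero_less_iff_neq_zero)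
  qed
  then have "A_infty_plus_const w \<le> ennreal B"
    unfolding A_infty_plus_const_def by (intro SUP_least) auto
  then show ?thesis by (auto simp: A_infty_plus_def le_less_trans)
qed

lemma tauberian_bound:
  assumes "tauberian_plus w \<alpha> \<le> K" "E \<in> sets lebesgue" "0 < weight_of w E" "weight_of w E < \<infinity>"
  shows "weight_of w {x. maximal_forward (indicator E) x > ennreal \<alpha>} \<le> K * weight_of w E"
proof -
  let ?u = "weight_of w {x. maximal_forward (indicator E) x > ennreal \<alpha>}"
  have "?u / weight_of w E \<le> tauberian_plus w \<alpha>"
    unfolding tauberian_plus_def by (rule SUP_upper) (use assms in auto)
  also have "\<dots> \<le> K" by fact
  finally have "?u / weight_of w E * weight_of w E \<le> K * weight_of w E"
    by (rule mult_right_mono) auto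
  moreover have "?u / weight_of w E * weight_of w E = ?u"
    using assms(3,4) by (simp add: ennreal_divide_times)
  ultimately show ?thesis by simp
qed

text \<open>The set \<open>L\<close> of points of \<open>(c, d)\<close> with small \<open>w\<close> cannot be dense near \<open>d\<close> when seen from every point
  of the left half of \<open>(c, d)\<close>, since by the tauberian bound that half would then have weight at most
  \<open>K\<close> times the weight of \<open>L\<close>, which is too small.\<close>

lemma superlevel_density:
  assumes \<alpha>: "0 < \<alpha>" "\<alpha> < 1" and K: "1 \<le> K" "tauberian_plus w \<alpha> \<le> ennreal K"
    and l: "0 < l" and cd: "c < d"
    and growth: "\<And>x. x \<in> {c<..<d} \<Longrightarrow> l * (x - c) \<le> W x - W c"
  shows "ennreal ((1 - \<alpha>) / 2 * (d - c)) \<le> emeasure lebesgue {x \<in> {c<..<d}. l / (5 * K) < w x}"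
proof -
  define q where "q = l / (5 * K)"
  define m where "m = (c + d) / 2"
  define H where "H = {x \<in> {c<..<d}. q < w x}"
  define L where "L = {x \<in> {c<..<d}. w x \<le> q}"
  have q: "0 < q" "q \<le> l / 5" "K * q = l / 5" using K l by (auto simp: q_def field_simps)
  have m: "c < m" "m < d" "m - c = (d - c) / 2" using cd by (auto simp: m_def field_simps)
  have sets: "H \<in> sets lebesgue" "L \<in> sets lebesgue" unfolding H_def L_def by (rule sets_w_superlevel)+
  have Wm: "l * ((d - c) / 2) \<le> W m - W c" using growth[of m] m by simp
  have "q * (d - c) \<le> l / 5 * (d - c)" using q cd by (intro mult_right_mono) auto
  also have "\<dots> \<le> l * ((d - c) / 2)" using l cd by simp
  finally have "W c + q * (d - c) \<le> W m" using Wm by linarith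
  \<comment> \<open>The tauberian bound is available only for sets of positive weight, and \<open>L\<close> may be null.
    A piece \<open>(c, t)\<close> with the weight that serves as the upper bound for \<open>L\<close> is therefore added.\<close>
  then obtain t where t: "c \<le> t" "t \<le> m" "W t = W c + q * (d - c)"
    using IVT'[of W c "W c + q * (d - c)" m] q m cd W_cont by auto
  have Wct: "weight_of w {c<..<t} = ennreal (q * (d - c))"
    using weight_Ioo[OF t(1)] t(3) by simp
  define E where "E = L \<union> {c<..<t}"
  have E: "E \<in> sets lebesgue" using sets by (auto simp: E_def)
  have "weight_of w L \<le> (\<integral>\<^sup>+ x. ennreal q * indicator {c<..<d} x \<partial>lebesgue)"
    unfolding weight_of_def
    by (intro nn_integral_mono) (auto simp: L_def indicator_def intro!: ennreal_leI)
  also have "\<dots> = ennreal (q * (d - c))"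
    using q cd by (simp add: nn_integral_cmult_indicator ennreal_mult)
  finally have wL: "weight_of w L \<le> ennreal (q * (d - c))" .
  \<comment> \<open>With threshold \<open>q = l / (5 K)\<close>, \<open>K\<close> times this bound is \<open>2/5\<close> of \<open>l (d - c)\<close>, which is less
    than the \<open>1/2\<close> carried by the left half.\<close>
  have "weight_of w E \<le> weight_of w L + weight_of w {c<..<t}"
    using sets E unfolding E_def by (simp add: weight_eq emeasure_subadditive)
  also have "\<dots> \<le> ennreal (q * (d - c)) + ennreal (q * (d - c))"
    using wL Wct by (intro add_mono) auto
  finally have wE: "weight_of w E \<le> ennreal (2 * (q * (d - c)))"
    using q cd by (simp flip: ennreal_plus)
  have "0 < weight_of w {c<..<t}" using Wct q cd by simp
  also have "\<dots> \<le> weight_of w E" by (rule weight_mono) (auto simp: E_def)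
  finally have taub: "weight_of w {x. maximal_forward (indicator E) x > ennreal \<alpha>} \<le> ennreal K * weight_of w E"
    using wE by (intro tauberian_bound[OF K(2) E]) (auto simp: le_less_trans)
  have "\<exists>x\<in>{c<..<m}. \<not> ennreal \<alpha> < maximal_forward (indicator E) x"
  proof (rule ccontr)
    assume "\<not> ?thesis"
    then have sub: "{c<..<m} \<subseteq> {x. maximal_forward (indicator E) x > ennreal \<alpha>}" by auto
    have "ennreal (l * ((d - c) / 2)) \<le> ennreal (W m - W c)"
      using Wm by (intro ennreal_leI)
    also have "\<dots> = weight_of w {c<..<m}" using weight_Ioo[of c m] m by simp
    also have "\<dots> \<le> weight_of w {x. maximal_forward (indicator E) x > ennreal \<alpha>}"
      by (rule weight_mono[OF sub])
    also have "\<dots> \<le> ennreal K * ennreal (2 * (q * (d - c)))"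
      using taub wE by (meson mult_left_mono order_trans zero_le)
    also have "\<dots> = ennreal (2 * (K * q) * (d - c))"
      using K by (simp add: ennreal_mult'[symmetric] mult_ac)
    finally have "l * ((d - c) / 2) \<le> 2 * (K * q) * (d - c)"
      using K q cd by (subst (asm) ennreal_le_iff) auto
    then show False using l cd by (simp add: q)
  qed
  then obtain x where x: "c < x" "x < m" "\<not> ennreal \<alpha> < maximal_forward (indicator E) x" by auto
  obtain V where V: "primitive V (indicator E)"
    using primitive_exists[OF locally_integrable_indicator[OF E]] .
  have xd: "x < d" using x m by auto
  have "\<not> (\<exists>y>x. \<alpha> * (y - x) < V y - V x)"
    using x(3) maximal_forward_gt_iff[OF V, of \<alpha> x] \<alpha> by simp
  then have "V d - V x \<le> \<alpha> * (d - x)" using xd not_less by blast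
  have "emeasure lebesgue (E \<inter> {x..d}) = ennreal (V d - V x)"
    using primitive_indicator[OF V E, of x d] xd by simp
  also have "\<dots> \<le> ennreal (\<alpha> * (d - x))" by (rule ennreal_leI) fact
  finally have Ex: "emeasure lebesgue (E \<inter> {x..d}) \<le> ennreal (\<alpha> * (d - x))" .
  have "ennreal (d - x) = emeasure lebesgue {x<..<d}" using xd by simp
  also have "\<dots> \<le> emeasure lebesgue (E \<inter> {x..d} \<union> H)"
  proof (rule emeasure_mono)
    show "{x<..<d} \<subseteq> E \<inter> {x..d} \<union> H"
      using x(1) by (auto simp: E_def L_def H_def not_less)
    show "E \<inter> {x..d} \<union> H \<in> sets lebesgue"
      by (intro sets.Un sets.Int E sets) simp
  qed
  also have "\<dots> \<le> emeasure lebesgue (E \<inter> {x..d}) + emeasure lebesgue H"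
    using E sets by (intro emeasure_subadditive) auto
  also have "\<dots> \<le> ennreal (\<alpha> * (d - x)) + emeasure lebesgue H"
    using Ex by (rule add_right_mono)
  finally have sum: "ennreal (d - x) \<le> ennreal (\<alpha> * (d - x)) + emeasure lebesgue H" .
  have "ennreal ((1 - \<alpha>) / 2 * (d - c)) \<le> emeasure lebesgue H"
  proof (cases "emeasure lebesgue H")
    case (real h)
    with sum have "d - x \<le> \<alpha> * (d - x) + h"
      using xd \<alpha> by (simp flip: ennreal_plus)
    moreover have "(1 - \<alpha>) * ((d - c) / 2) \<le> (1 - \<alpha>) * (d - x)"
      using x m \<alpha> by (intro mult_left_mono) auto
    moreover have "(1 - \<alpha>) / 2 * (d - c) = (1 - \<alpha>) * ((d - c) / 2)"
      "(1 - \<alpha>) * (d - x) = (d - x) - \<alpha> * (d - x)" by (simp_all add: algebra_simps)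
    ultimately have "(1 - \<alpha>) / 2 * (d - c) \<le> h" by linarith
    then show ?thesis using real by (auto intro!: ennreal_leI)
  qed auto
  then show ?thesis by (simp add: H_def q_def)
qed

text \<open>Summation of the preceding density estimate over the components.  Both sides are Lebesgue
  measures, which is what allows an integration over the level \<open>l\<close> without a logarithmic loss.\<close>

lemma level_measure_le:
  assumes \<alpha>: "0 < \<alpha>" "\<alpha> < 1" and K: "1 \<le> K" "tauberian_plus w \<alpha> \<le> ennreal K"
    and l: "0 < l" and ab: "a < b"
  shows "emeasure lebesgue (level a b l)
    \<le> ennreal (2 / (1 - \<alpha>)) * emeasure lebesgue {x \<in> {a<..<b}. l / (5 * K) < w x}"
proof -
  let ?H = "{x. l / (5 * K) < w x}"
  have H: "?H \<in> sets lebesgue" by (rule sets_w_superlevel)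
  have lev: "level a b l \<in> sets lebesgue" using level_open[OF ab] l by (auto intro: borel_open)
  have "emeasure lebesgue (level a b l) = (\<integral>\<^sup>+ x \<in> level a b l. 1 \<partial>lebesgue)"
    using lev by simp
  also have "\<dots> \<le> (\<integral>\<^sup>+ x \<in> level a b l. ennreal (2 / (1 - \<alpha>)) * indicator ?H x \<partial>lebesgue)"
  proof (rule nn_integral_mono_components)
    fix c d assume cd: "c < d" "{c<..<d} \<subseteq> level a b l" "c \<notin> level a b l" "d \<notin> level a b l"
    have "ennreal ((1 - \<alpha>) / 2 * (d - c)) \<le> emeasure lebesgue {x \<in> {c<..<d}. l / (5 * K) < w x}"
      using level_component(4)[OF ab _ cd] l by (intro superlevel_density[OF \<alpha> K l cd(1)]) auto
    then have "ennreal (2 / (1 - \<alpha>)) * ennreal ((1 - \<alpha>) / 2 * (d - c))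
        \<le> ennreal (2 / (1 - \<alpha>)) * emeasure lebesgue {x \<in> {c<..<d}. l / (5 * K) < w x}"
      by (rule mult_left_mono) auto
    also have "ennreal (2 / (1 - \<alpha>)) * ennreal ((1 - \<alpha>) / 2 * (d - c)) = ennreal (d - c)"
      using \<alpha> cd by (simp add: ennreal_mult'[symmetric])
    also have "ennreal (2 / (1 - \<alpha>)) * emeasure lebesgue {x \<in> {c<..<d}. l / (5 * K) < w x}
       = (\<integral>\<^sup>+ x. ennreal (2 / (1 - \<alpha>)) * indicator {x \<in> {c<..<d}. l / (5 * K) < w x} x \<partial>lebesgue)"
      by (rule nn_integral_cmult_indicator[symmetric]) (rule sets_w_superlevel)
    also have "\<dots> = (\<integral>\<^sup>+ x \<in> {c<..<d}. ennreal (2 / (1 - \<alpha>)) * indicator ?H x \<partial>lebesgue)"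
      by (intro nn_integral_cong) (auto simp: indicator_def)
    finally show "(\<integral>\<^sup>+ x \<in> {c<..<d}. 1 \<partial>lebesgue)
        \<le> (\<integral>\<^sup>+ x \<in> {c<..<d}. ennreal (2 / (1 - \<alpha>)) * indicator ?H x \<partial>lebesgue)"
      using cd by simp
  qed (use level_open[OF ab] l H in auto)
  also have "\<dots> \<le> (\<integral>\<^sup>+ x. ennreal (2 / (1 - \<alpha>)) * indicator {x \<in> {a<..<b}. l / (5 * K) < w x} x \<partial>lebesgue)"
    by (intro nn_integral_mono) (auto simp: indicator_def level_def)
  also have "\<dots> = ennreal (2 / (1 - \<alpha>)) * emeasure lebesgue {x \<in> {a<..<b}. l / (5 * K) < w x}"
    by (rule nn_integral_cmult_indicator) (rule sets_w_superlevel)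
  finally show ?thesis .
qed

text \<open>Dyadic levels start at \<open>l\<close>, so the part of \<open>M\<close> below \<open>l\<close> costs \<open>l (b - a)\<close>.  As \<open>l\<close> is arbitrary,
  this term disappears in the limit.\<close>

lemma integral_M_le:
  assumes \<alpha>: "0 < \<alpha>" "\<alpha> < 1" and K: "1 \<le> K" "tauberian_plus w \<alpha> \<le> ennreal K"
    and ab: "a < b" and l: "0 < l"
  shows "(\<integral>\<^sup>+ x \<in> {a<..<b}. M a b x \<partial>lebesgue)
    \<le> ennreal (l * (b - a)) + ennreal (20 * K / (1 - \<alpha>)) * weight_of w {a<..<b}"
proof -
  define B where "B = 2 / (1 - \<alpha>)"
  have B: "B > 0" using \<alpha> by (simp add: B_def)
  define G where "G k = {x \<in> {a<..<b}. 2 ^ k * l / (5 * K) < w x}" for k :: nat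
  have lev: "level a b (2 ^ k * l) \<in> sets lebesgue" for k
    using level_open(1)[OF ab, of "2 ^ k * l"] l by (auto intro: borel_open)
  have G: "G k \<in> sets lebesgue" for k unfolding G_def by (rule sets_w_superlevel)
  have "(\<integral>\<^sup>+ x \<in> {a<..<b}. M a b x \<partial>lebesgue)
      \<le> (\<integral>\<^sup>+ x. ennreal l * indicator {a<..<b} x
            + (\<Sum>k. ennreal (2 ^ k * l) * indicator (level a b (2 ^ k * l)) x) \<partial>lebesgue)"
    by (intro nn_integral_mono)
      (use ennreal_le_dyadic_sum[OF l] in \<open>auto simp: indicator_def level_def\<close>)
  also have "\<dots> = ennreal (l * (b - a)) + (\<Sum>k. ennreal (2 ^ k * l) * emeasure lebesgue (level a b (2 ^ k * l)))"
  proof (subst nn_integral_add)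
    have "(\<integral>\<^sup>+ x. (\<Sum>k. ennreal (2 ^ k * l) * indicator (level a b (2 ^ k * l)) x) \<partial>lebesgue)
        = (\<Sum>k. ennreal (2 ^ k * l) * emeasure lebesgue (level a b (2 ^ k * l)))"
      using lev by (simp only: nn_integral_suminf borel_measurable_indicator
          borel_measurable_times_ennreal borel_measurable_const nn_integral_cmult_indicator)
    moreover have "emeasure lebesgue {a<..<b} = ennreal (b - a)" using ab by simp
    ultimately show "(\<integral>\<^sup>+ x. ennreal l * indicator {a<..<b} x \<partial>lebesgue)
          + (\<integral>\<^sup>+ x. (\<Sum>k. ennreal (2 ^ k * l) * indicator (level a b (2 ^ k * l)) x) \<partial>lebesgue)
        = ennreal (l * (b - a)) + (\<Sum>k. ennreal (2 ^ k * l) * emeasure lebesgue (level a b (2 ^ k * l)))"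
      using l ab by (simp add: nn_integral_cmult_indicator ennreal_mult del: emeasure_completion)
  qed (use lev in \<open>auto intro!: borel_measurable_suminf_order borel_measurable_times_ennreal borel_measurable_indicator\<close>)
  also have "(\<Sum>k. ennreal (2 ^ k * l) * emeasure lebesgue (level a b (2 ^ k * l)))
      \<le> (\<Sum>k. ennreal B * (ennreal (2 ^ k * l) * emeasure lebesgue (G k)))"
  proof (intro suminf_le summableI allI)
    fix k
    have "ennreal (2 ^ k * l) * emeasure lebesgue (level a b (2 ^ k * l))
       \<le> ennreal (2 ^ k * l) * (ennreal B * emeasure lebesgue (G k))"
      unfolding G_def B_def using l by (intro mult_left_mono level_measure_le[OF \<alpha> K _ ab]) auto
    then show "ennreal (2 ^ k * l) * emeasure lebesgue (level a b (2 ^ k * l))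
       \<le> ennreal B * (ennreal (2 ^ k * l) * emeasure lebesgue (G k))" by (simp add: ac_simps)
  qed
  also have "\<dots> = ennreal B * (\<integral>\<^sup>+ x. (\<Sum>k. ennreal (2 ^ k * l) * indicator (G k) x) \<partial>lebesgue)"
    using G by (simp add: nn_integral_suminf nn_integral_cmult_indicator)
  also have "\<dots> \<le> ennreal B * (\<integral>\<^sup>+ x. ennreal (10 * K) * (ennreal (w x) * indicator {a<..<b} x) \<partial>lebesgue)"
  proof (intro mult_left_mono nn_integral_mono)
    fix x
    show "(\<Sum>k. ennreal (2 ^ k * l) * indicator (G k) x) \<le> ennreal (10 * K) * (ennreal (w x) * indicator {a<..<b} x)"
    proof (cases "x \<in> {a<..<b}")
      case True
      have "2 ^ k * l / (5 * K) < w x \<longleftrightarrow> 2 ^ k * l < 5 * K * w x" for k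
        using K by (simp add: field_simps)
      then have "(\<Sum>k. ennreal (2 ^ k * l) * indicator (G k) x)
         = (\<Sum>k. ennreal (2 ^ k * l) * indicator {y. 2 ^ k * l < y} (5 * K * w x))"
        using True by (simp add: G_def indicator_def)
      also have "\<dots> \<le> ennreal (2 * (5 * K * w x))"
        using l K nonneg by (intro dyadic_sum_le) auto
      finally show ?thesis using True K by (simp add: ennreal_mult'[symmetric] mult.assoc)
    next
      case False
      then have "indicator (G k) x = (0::ennreal)" for k by (auto simp: G_def)
      then show ?thesis by simp
    qed
  qed auto
  also have "\<dots> = ennreal B * (ennreal (10 * K) * weight_of w {a<..<b})"
    unfolding weight_of_def
    by (subst nn_integral_cmult)
      (auto intro!: borel_measurable_times_ennreal measurable_ennreal_w
        borel_measurable_indicator)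
  also have "\<dots> = ennreal (20 * K / (1 - \<alpha>)) * weight_of w {a<..<b}"
    using B K by (simp add: B_def mult.assoc[symmetric] ennreal_mult'[symmetric])
  finally show ?thesis by (simp add: add_left_mono)
qed

lemma tauberian_imp_A_infty_plus:
  assumes \<alpha>: "0 < \<alpha>" "\<alpha> < 1" and fin: "tauberian_plus w \<alpha> < \<infinity>"
  shows "A_infty_plus w"
proof -
  obtain k where k: "tauberian_plus w \<alpha> = ennreal k"
    using fin by (cases "tauberian_plus w \<alpha>") auto
  define K where "K = max 1 k"
  have K: "1 \<le> K" "tauberian_plus w \<alpha> \<le> ennreal K"
    by (auto simp: K_def k intro: ennreal_leI)
  show ?thesis
  proof (rule A_infty_plusI)
    fix a b :: real assume ab: "a < b"
    show "(\<integral>\<^sup>+ x \<in> {a<..<b}. M a b x \<partial>lebesgue) \<le> ennreal (20 * K / (1 - \<alpha>)) * weight_of w {a<..<b}"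
    proof (rule ennreal_le_epsilon)
      fix e :: real assume "0 < e"
      then show "(\<integral>\<^sup>+ x \<in> {a<..<b}. M a b x \<partial>lebesgue)
          \<le> ennreal (20 * K / (1 - \<alpha>)) * weight_of w {a<..<b} + ennreal e"
        using integral_M_le[OF \<alpha> K ab, of "e / (b - a)"] ab by (simp add: add.commute)
    qed
  qed
qed

end

section \<open>Geometric decay of the excess of the maximal function\<close>

context weight
begin

text \<open>The constant is enlarged to at least \<open>1\<close> so that the decay factor \<open>2 A / (2 A + 1)\<close> is positive and
  can be raised to real powers.\<close>

lemma A_infty_plusD:
  assumes "A_infty_plus w"
  shows "\<exists>A\<ge>1. \<forall>a b. a < b \<longrightarrow>
    (\<integral>\<^sup>+ x \<in> {a<..<b}. M a b x \<partial>lebesgue) \<le> ennreal (A * (W b - W a))"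
proof -
  obtain r where r: "A_infty_plus_const w = ennreal r"
    using assms unfolding A_infty_plus_def by (cases "A_infty_plus_const w") auto
  define A where "A = max 1 r"
  have A: "1 \<le> A" "A_infty_plus_const w \<le> ennreal A"
    by (auto simp: A_def r intro: ennreal_leI)
  have "(\<integral>\<^sup>+ x \<in> {a<..<b}. M a b x \<partial>lebesgue) \<le> ennreal (A * (W b - W a))" if ab: "a < b" for a b
  proof -
    let ?u = "\<integral>\<^sup>+ x \<in> {a<..<b}. M a b x \<partial>lebesgue" and ?v = "weight_of w {a<..<b}"
    have v: "?v = ennreal (W b - W a)" using weight_Ioo ab by simp
    have "?u / ?v \<le> A_infty_plus_const w"
      unfolding A_infty_plus_const_def by (rule SUP_upper2[of "(a, b)"]) (use ab in auto)
    also have "\<dots> \<le> ennreal A" by fact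
    finally have le: "?u / ?v \<le> ennreal A" .
    show ?thesis
    proof (cases "?v = 0")
      case True
      then have "?u = 0" using le by (auto simp: top_unique split: if_splits)
      then show ?thesis by simp
    next
      case False
      have "?u = ?u / ?v * ?v" using False v by (simp add: ennreal_divide_times)
      also have "\<dots> \<le> ennreal A * ?v" by (rule mult_right_mono[OF le]) simp
      also have "\<dots> = ennreal (A * (W b - W a))"
        using A(1) W_mono ab by (simp add: v ennreal_mult)
      finally show ?thesis .
    qed
  qed
  with A(1) show ?thesis by blast
qed

end

locale A_infty_weight = weight +
  fixes A :: real
  assumes A: "1 \<le> A"
    and integral_M_le_A: "a < b \<Longrightarrow> (\<integral>\<^sup>+ x \<in> {a<..<b}. M a b x \<partial>lebesgue) \<le> ennreal (A * (W b - W a))"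
begin

text \<open>The hypothesis on \<open>b\<close> makes the average over a component at most \<open>l\<close> even if the component is cut
  off by \<open>b\<close>.  Then the Fujii-Wilson condition on the component \<open>(c, d)\<close> yields the bound
  \<open>A w(c, d) \<le> A l (d - c)\<close>.\<close>

lemma integral_M_level_le:
  assumes ab: "a < b" and l: "0 \<le> l"
    and top: "\<And>y. y \<in> {a..b} \<Longrightarrow> W b - W y \<le> l * (b - y)"
  shows "(\<integral>\<^sup>+ x \<in> level a b l. M a b x \<partial>lebesgue) \<le> ennreal (A * l) * emeasure lebesgue (level a b l)"
proof -
  have "(\<integral>\<^sup>+ x \<in> level a b l. M a b x \<partial>lebesgue) \<le> (\<integral>\<^sup>+ x \<in> level a b l. ennreal (A * l) \<partial>lebesgue)"
  proof (rule nn_integral_mono_components)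
    fix c d assume cd: "c < d" "{c<..<d} \<subseteq> level a b l" "c \<notin> level a b l" "d \<notin> level a b l"
    note comp = level_component[OF ab l cd]
    have "(\<integral>\<^sup>+ x \<in> {c<..<d}. M a b x \<partial>lebesgue) \<le> (\<integral>\<^sup>+ x \<in> {c<..<d}. M c d x \<partial>lebesgue)"
      using M_localize[OF ab l cd] by (intro nn_integral_mono) (auto simp: indicator_def)
    also have "\<dots> \<le> ennreal (A * (W d - W c))" by (rule integral_M_le_A[OF cd(1)])
    also have "W d - W c \<le> l * (d - c)"
      using comp(1,2,5) top[of c] cd(1) by (cases "d < b") auto
    then have "ennreal (A * (W d - W c)) \<le> ennreal (A * l * (d - c))"
      using A by (auto intro!: ennreal_leI simp: mult.assoc)
    also have "\<dots> = (\<integral>\<^sup>+ x \<in> {c<..<d}. ennreal (A * l) \<partial>lebesgue)"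
      using A l cd(1) by (subst nn_integral_cmult_indicator) (auto simp: ennreal_mult')
    finally show "(\<integral>\<^sup>+ x \<in> {c<..<d}. M a b x \<partial>lebesgue) \<le> (\<integral>\<^sup>+ x \<in> {c<..<d}. ennreal (A * l) \<partial>lebesgue)" .
  qed (use level_open[OF ab l] measurable_M[OF ab] in auto)
  also have "\<dots> = ennreal (A * l) * emeasure lebesgue (level a b l)"
    using level_open[OF ab l] by (intro nn_integral_cmult_indicator) (auto intro: borel_open)
  finally show ?thesis .
qed

definition excess :: "real \<Rightarrow> real \<Rightarrow> real \<Rightarrow> ennreal" where
  "excess a b l = (\<integral>\<^sup>+ x \<in> {a<..<b}. (M a b x - ennreal l) \<partial>lebesgue)"

text \<open>The factor by which the excess shrinks when the level doubles.\<close>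

definition rho :: real where "rho = 2 * A / (2 * A + 1)"

lemma rho: "0 < rho" "rho < 1"
  using A by (auto simp: rho_def)

text \<open>Let \<open>\<Psi>\<close> be the excess and \<open>L\<close> the level set at \<open>2 l\<close>.  Raising the level from \<open>l\<close> to \<open>2 l\<close> loses at
  least \<open>l\<close> at each point of \<open>L\<close>, that is, \<open>\<Psi>(l) \<ge> \<Psi>(2 l) + l |L|\<close>.  Conversely \<open>\<Psi>(2 l)\<close> is at most the
  integral of the maximal function over \<open>L\<close>, hence at most \<open>2 A l |L|\<close>.  So the loss is at least
  \<open>\<Psi>(2 l) / (2 A)\<close>.\<close>

lemma excess_double_le:
  assumes ab: "a < b" and l: "0 \<le> l"
    and top: "\<And>y. y \<in> {a..b} \<Longrightarrow> W b - W y \<le> l * (b - y)"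
  shows "excess a b (2 * l) \<le> ennreal rho * excess a b l"
proof -
  let ?L = "level a b (2 * l)"
  have l2: "0 \<le> 2 * l" using l by simp
  have L: "?L \<in> sets lebesgue" using level_open[OF ab l2] by (auto intro: borel_open)
  have top2: "W b - W y \<le> 2 * l * (b - y)" if "y \<in> {a..b}" for y
  proof -
    have "l * (b - y) \<le> 2 * l * (b - y)" using l that by (intro mult_right_mono) auto
    then show ?thesis using top[OF that] by linarith
  qed
  have meas: "(\<lambda>x. (M a b x - ennreal (2 * l)) * indicator {a<..<b} x) \<in> borel_measurable lebesgue"
    using measurable_M[OF ab]
    by (intro borel_measurable_times_ennreal borel_measurable_minus_ennreal borel_measurable_indicator) auto
  have "excess a b (2 * l) \<le> (\<integral>\<^sup>+ x \<in> ?L. M a b x \<partial>lebesgue)"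
    unfolding excess_def
  proof (rule nn_integral_mono)
    fix x
    have "M a b x - ennreal (2 * l) \<le> M a b x" by (simp add: ennreal_minus_le_iff)
    moreover have "M a b x - ennreal (2 * l) = 0" if "\<not> ennreal (2 * l) < M a b x"
      using that by (intro diff_eq_0_ennreal) (auto simp: not_less intro: le_less_trans)
    ultimately show "(M a b x - ennreal (2 * l)) * indicator {a<..<b} x \<le> M a b x * indicator ?L x"
      by (auto simp: indicator_def level_def)
  qed
  also have "\<dots> \<le> ennreal (A * (2 * l)) * emeasure lebesgue ?L"
    by (rule integral_M_level_le[OF ab l2 top2])
  finally have up: "excess a b (2 * l) \<le> ennreal (2 * A) * (ennreal l * emeasure lebesgue ?L)"
    using A l by (simp add: mult.assoc[symmetric] ennreal_mult'[symmetric] mult.commute[of _ 2] mult.left_commute[of _ 2] del: emeasure_completion)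
  have "excess a b (2 * l) + ennreal l * emeasure lebesgue ?L
     = (\<integral>\<^sup>+ x. (M a b x - ennreal (2 * l)) * indicator {a<..<b} x + ennreal l * indicator ?L x \<partial>lebesgue)"
    unfolding excess_def using L
    by (subst nn_integral_add[OF meas]) (auto simp: nn_integral_cmult_indicator simp del: emeasure_completion)
  also have "\<dots> \<le> excess a b l"
    unfolding excess_def
  proof (rule nn_integral_mono)
    fix x
    have "M a b x - ennreal (2 * l) \<le> M a b x - ennreal l"
      using l by (intro ennreal_minus_mono ennreal_leI) auto
    moreover have "M a b x - ennreal (2 * l) + ennreal l \<le> M a b x - ennreal l" if "ennreal (2 * l) < M a b x"
      using that l
      by (cases "M a b x") (auto simp: ennreal_minus ennreal_less_iff simp flip: ennreal_plus intro!: ennreal_leI)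
    ultimately show "(M a b x - ennreal (2 * l)) * indicator {a<..<b} x + ennreal l * indicator ?L x
       \<le> (M a b x - ennreal l) * indicator {a<..<b} x"
      by (auto simp: indicator_def level_def)
  qed
  finally have low: "excess a b (2 * l) + ennreal l * emeasure lebesgue ?L \<le> excess a b l" .
  have "ennreal (2 * A + 1) * excess a b (2 * l)
      = ennreal (2 * A) * excess a b (2 * l) + excess a b (2 * l)"
    using A by (simp add: ennreal_plus distrib_right)
  also have "\<dots> \<le> ennreal (2 * A) * excess a b (2 * l) + ennreal (2 * A) * (ennreal l * emeasure lebesgue ?L)"
    using up by (rule add_left_mono)
  also have "\<dots> = ennreal (2 * A) * (excess a b (2 * l) + ennreal l * emeasure lebesgue ?L)"
    by (simp add: distrib_left)
  also have "\<dots> \<le> ennreal (2 * A) * excess a b l"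
    using low by (rule mult_left_mono) simp
  finally have "ennreal (1 / (2 * A + 1)) * (ennreal (2 * A + 1) * excess a b (2 * l))
      \<le> ennreal (1 / (2 * A + 1)) * (ennreal (2 * A) * excess a b l)"
    by (rule mult_left_mono) simp
  moreover have "ennreal (1 / (2 * A + 1)) * ennreal (2 * A + 1) = 1"
    "ennreal (1 / (2 * A + 1)) * ennreal (2 * A) = ennreal rho"
    using A by (simp_all add: ennreal_mult'[symmetric] rho_def del: ennreal_plus)
  ultimately show ?thesis
    by (simp only: mult.assoc[symmetric] mult_1_left)
qed

lemma excess_decay:
  assumes ab: "a < b" and l: "0 \<le> l"
    and top: "\<And>y. y \<in> {a..b} \<Longrightarrow> W b - W y \<le> l * (b - y)"
  shows "excess a b (2 ^ k * l) \<le> ennreal (rho ^ k * (A * (W b - W a)))"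
proof (induction k)
  case 0
  have "excess a b l \<le> (\<integral>\<^sup>+ x \<in> {a<..<b}. M a b x \<partial>lebesgue)"
    unfolding excess_def by (intro nn_integral_mono mult_right_mono) (auto simp: ennreal_minus_le_iff)
  then show ?case using integral_M_le_A[OF ab] by simp
next
  case (Suc k)
  have top': "W b - W y \<le> 2 ^ k * l * (b - y)" if "y \<in> {a..b}" for y
  proof -
    have "1 * l * (b - y) \<le> 2 ^ k * l * (b - y)" using l that by (intro mult_right_mono) auto
    then show ?thesis using top[OF that] by linarith
  qed
  have "excess a b (2 * (2 ^ k * l)) \<le> ennreal rho * excess a b (2 ^ k * l)"
    using l by (intro excess_double_le[OF ab _ top']) auto
  also have "\<dots> \<le> ennreal rho * ennreal (rho ^ k * (A * (W b - W a)))"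
    using Suc.IH by (rule mult_left_mono) simp
  finally show ?case using rho by (simp add: ennreal_mult'[symmetric] mult.assoc)
qed

text \<open>Almost everywhere \<open>w \<le> M a b\<close>, and \<open>M a b \<le> l + (M a b - l)\<close> with truncated subtraction; only the
  first summand is sensitive to the size of \<open>F\<close>.\<close>

lemma weight_le_excess:
  assumes ab: "a < b" and F: "F \<in> sets lebesgue" "F \<subseteq> {a<..<b}"
  shows "weight_of w F \<le> ennreal l * emeasure lebesgue F + excess a b l"
proof -
  have "weight_of w F \<le> (\<integral>\<^sup>+ x. ennreal l * indicator F x + (M a b x - ennreal l) * indicator {a<..<b} x \<partial>lebesgue)"
    unfolding weight_of_def
  proof (rule nn_integral_mono_AE)
    show "AE x in lebesgue. ennreal (w x) * indicator F x
        \<le> ennreal l * indicator F x + (M a b x - ennreal l) * indicator {a<..<b} x"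
      using AE_w_le_M[OF ab]
    proof eventually_elim
      case (elim x)
      have "M a b x \<le> ennreal l + (M a b x - ennreal l)"
        using ennreal_minus_le_iff[of "M a b x" "ennreal l" "M a b x - ennreal l"] by simp
      then show ?case using elim F(2) by (auto simp: indicator_def)
    qed
  qed
  also have "\<dots> = ennreal l * emeasure lebesgue F + excess a b l"
    unfolding excess_def using F(1) measurable_M[OF ab]
    by (subst nn_integral_add)
      (auto simp: nn_integral_cmult_indicator simp del: emeasure_completion
        intro!: borel_measurable_times_ennreal borel_measurable_minus_ennreal borel_measurable_indicator)
  finally show ?thesis .
qed

text \<open>The decay estimate needs an interval at whose right end the averages are not larger than the
  initial level.  Such an end \<open>z\<close> is a minimum point of \<open>W t - l t\<close> on \<open>[a, c]\<close>.  The choice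
  of \<open>l\<close> as twice \<open>w(a, c) / (c - b)\<close> makes the value at \<open>c\<close> smaller than all values on \<open>[a, b]\<close>, so
  that \<open>z > b\<close> and \<open>F\<close> is contained in \<open>(a, z)\<close>.\<close>

lemma weight_le_one_sided:
  assumes abc: "a < b" "b < c" and F: "F \<in> sets lebesgue" "F \<subseteq> {a<..b}"
  shows "weight_of w F \<le> ennreal (2 ^ k * (2 * (W c - W a) / (c - b))) * emeasure lebesgue F
      + ennreal (rho ^ k * (A * (W c - W a)))"
proof (cases "W c = W a")
  case True
  have "weight_of w F \<le> weight_of w {a<..<c}" by (rule weight_mono) (use F abc in auto)
  also have "\<dots> = 0" using weight_Ioo[of a c] abc True by simp
  finally show ?thesis by simp
next
  case False
  then have pos: "W a < W c" using W_mono[of a c] abc by simp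
  define l where "l = 2 * (W c - W a) / (c - b)"
  have l: "0 < l" "l * (c - b) = 2 * (W c - W a)" using pos abc by (auto simp: l_def)
  have "continuous_on {a..c} (\<lambda>t. W t - l * t)" by (intro continuous_intros W_cont)
  then obtain z where z: "z \<in> {a..c}" "\<And>y. y \<in> {a..c} \<Longrightarrow> W z - l * z \<le> W y - l * y"
    using continuous_attains_inf[of "{a..c}" "\<lambda>t. W t - l * t"] abc by auto
  have bz: "b < z"
  proof (rule ccontr)
    assume "\<not> b < z"
    then have "l * (c - b) \<le> l * (c - z)" using l by (intro mult_left_mono) auto
    moreover have "W z - l * z \<le> W c - l * c" using z(2)[of c] abc by simp
    moreover have "W a \<le> W z" using z(1) by (intro W_mono) auto
    ultimately show False using l(2) pos by (simp add: algebra_simps)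
  qed
  have az: "a < z" using bz abc by simp
  have top: "W z - W y \<le> l * (z - y)" if "y \<in> {a..z}" for y
    using z(2)[of y] that z(1) by (simp add: algebra_simps)
  have "weight_of w F \<le> ennreal (2 ^ k * l) * emeasure lebesgue F + excess a z (2 ^ k * l)"
    by (rule weight_le_excess[OF az F(1)]) (use F(2) bz in auto)
  also have "excess a z (2 ^ k * l) \<le> ennreal (rho ^ k * (A * (W z - W a)))"
    using l by (intro excess_decay[OF az _ top]) auto
  also have "\<dots> \<le> ennreal (rho ^ k * (A * (W c - W a)))"
    using rho A W_mono[of z c] z(1) by (intro ennreal_leI mult_left_mono) auto
  finally show ?thesis by (simp add: l_def add_left_mono)
qed

lemma weight_Ioc_subadditive: "c \<le> x \<Longrightarrow> x \<le> y \<Longrightarrow> F \<in> sets lebesgue \<Longrightarrow>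
  weight_of w (F \<inter> {c<..y}) \<le> weight_of w (F \<inter> {c<..x}) + weight_of w (F \<inter> {x<..y})"
proof -
  assume *: "c \<le> x" "x \<le> y" "F \<in> sets lebesgue"
  have "weight_of w (F \<inter> {c<..y}) \<le> weight_of w ((F \<inter> {c<..x}) \<union> (F \<inter> {x<..y}))"
    by (rule weight_mono) (use * in auto)
  also have "\<dots> \<le> weight_of w (F \<inter> {c<..x}) + weight_of w (F \<inter> {x<..y})"
  proof -
    have "F \<inter> {c<..x} \<in> sets lebesgue" "F \<inter> {x<..y} \<in> sets lebesgue"
      using *(3) by auto
    then show ?thesis by (simp add: weight_eq emeasure_subadditive)
  qed
  finally show ?thesis .
qed

text \<open>The interval is cut at the points \<open>X n\<close> whose distance to \<open>d\<close> is \<open>(d - c) / 2\<^sup>n\<close>.  The weight of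
  \<open>F\<close> in the slice from \<open>X n\<close> to \<open>X (n + 1)\<close> is compared with the weight of the slice and
  the next one, and the resulting sum of overlapping pieces telescopes to at most twice the whole.\<close>

lemma weight_thin_le:
  assumes cd: "c < d" and s: "0 \<le> s" and F: "F \<in> sets lebesgue"
    and thin: "\<And>x. x \<in> {c..<d} \<Longrightarrow> emeasure lebesgue (F \<inter> {x<..<d}) \<le> ennreal (s * (d - x))"
  shows "weight_of w (F \<inter> {c<..<d}) \<le> ennreal (2 * (8 * s * 2 ^ k + A * rho ^ k)) * weight_of w {c<..<d}"
proof -
  define \<eta> where "\<eta> = 8 * s * 2 ^ k + A * rho ^ k"
  have \<eta>: "0 \<le> \<eta>" using s A rho by (auto simp: \<eta>_def)
  define X where "X n = d - (d - c) / 2 ^ n" for n :: nat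
  have X0: "X 0 = c" by (simp add: X_def)
  have X_less: "X n < d" for n using cd by (simp add: X_def)
  have X_gap: "X (Suc n) - X n = (d - X n) / 2" "d - X (Suc n) = (d - X n) / 2" for n
    by (simp_all add: X_def field_simps)
  have X_mono: "X n < X (Suc n)" for n using X_gap(1)[of n] X_less[of n] by simp
  have X_ge: "c \<le> X n" for n
    by (induction n) (use X0 X_mono in \<open>auto intro: order_trans less_imp_le\<close>)
  have slice: "weight_of w (F \<inter> {X n<..X (Suc n)}) \<le> ennreal (\<eta> * (W (X (Suc (Suc n))) - W (X n)))" for n
  proof -
    define h where "h = d - X n"
    have h: "0 < h" using X_less by (simp add: h_def)
    let ?V = "W (X (Suc (Suc n))) - W (X n)"
    have V: "0 \<le> ?V" using W_mono X_mono[of n] X_mono[of "Suc n"] by simp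
    have gap: "X (Suc (Suc n)) - X (Suc n) = h / 4"
      using X_gap[of "Suc n"] X_gap[of n] by (simp add: h_def)
    have "emeasure lebesgue (F \<inter> {X n<..X (Suc n)}) \<le> emeasure lebesgue (F \<inter> {X n<..<d})"
      using F X_less[of "Suc n"] by (intro emeasure_mono) auto
    also have "\<dots> \<le> ennreal (s * h)" unfolding h_def by (rule thin) (use X_ge X_less in auto)
    finally have Fn: "emeasure lebesgue (F \<inter> {X n<..X (Suc n)}) \<le> ennreal (s * h)" .
    have "weight_of w (F \<inter> {X n<..X (Suc n)})
        \<le> ennreal (2 ^ k * (2 * ?V / (X (Suc (Suc n)) - X (Suc n)))) * emeasure lebesgue (F \<inter> {X n<..X (Suc n)})
          + ennreal (rho ^ k * (A * ?V))"
      using F by (intro weight_le_one_sided X_mono) auto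
    also have "\<dots> \<le> ennreal (2 ^ k * (2 * ?V / (h / 4))) * ennreal (s * h) + ennreal (rho ^ k * (A * ?V))"
      unfolding gap by (intro add_right_mono mult_left_mono Fn) simp
    also have "\<dots> = ennreal (2 ^ k * (2 * ?V / (h / 4)) * (s * h) + rho ^ k * (A * ?V))"
      using V h s A rho by (simp add: ennreal_mult'[symmetric] flip: ennreal_plus)
    also have "2 ^ k * (2 * ?V / (h / 4)) * (s * h) + rho ^ k * (A * ?V) = \<eta> * ?V"
      using h by (simp add: \<eta>_def field_simps)
    finally show ?thesis .
  qed
  \<comment> \<open>The increments of \<open>W (X (n + 1)) + W (X n)\<close> are exactly the weights of the double slices.\<close>
  have part: "weight_of w (F \<inter> {c<..X n}) \<le> ennreal (\<eta> * (W (X (Suc n)) + W (X n) - W (X 1) - W c))" for n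
  proof (induction n)
    case 0
    then show ?case by (simp add: X0 weight_of_def)
  next
    case (Suc n)
    have mono: "W (X (Suc n)) \<le> W (X (Suc (Suc n)))" "W c \<le> W (X n)" "W (X n) \<le> W (X (Suc n))"
      "W (X 1) \<le> W (X (Suc n))"
    proof -
      have "incseq X" by (rule incseq_SucI) (use X_mono less_imp_le in blast)
      then show "W (X 1) \<le> W (X (Suc n))" by (intro W_mono) (simp add: incseq_def)
    qed (use X_mono X_ge in \<open>auto intro!: W_mono intro: less_imp_le\<close>)
    have "weight_of w (F \<inter> {c<..X (Suc n)})
        \<le> weight_of w (F \<inter> {c<..X n}) + weight_of w (F \<inter> {X n<..X (Suc n)})"
      by (rule weight_Ioc_subadditive[OF X_ge _ F]) (use X_mono less_imp_le in blast)
    also have "\<dots> \<le> ennreal (\<eta> * (W (X (Suc n)) + W (X n) - W (X 1) - W c))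
        + ennreal (\<eta> * (W (X (Suc (Suc n))) - W (X n)))"
      by (intro add_mono Suc.IH slice)
    also have "\<dots> = ennreal (\<eta> * (W (X (Suc n)) + W (X n) - W (X 1) - W c) + \<eta> * (W (X (Suc (Suc n))) - W (X n)))"
      using mono \<eta> by (intro ennreal_plus[symmetric] mult_nonneg_nonneg) auto
    also have "\<eta> * (W (X (Suc n)) + W (X n) - W (X 1) - W c) + \<eta> * (W (X (Suc (Suc n))) - W (X n))
        = \<eta> * (W (X (Suc (Suc n))) + W (X (Suc n)) - W (X 1) - W c)"
      by (simp add: algebra_simps)
    finally show ?case .
  qed
  have bound: "weight_of w (F \<inter> {c<..X n}) \<le> ennreal (2 * \<eta> * (W d - W c))" for n
  proof -
    have "W (X (Suc n)) \<le> W d" "W (X n) \<le> W d" "W c \<le> W (X 1)"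
      using X_less X_ge by (auto intro!: W_mono intro: less_imp_le)
    then have "\<eta> * (W (X (Suc n)) + W (X n) - W (X 1) - W c) \<le> \<eta> * (2 * (W d - W c))"
      using \<eta> by (intro mult_left_mono) auto
    then show ?thesis using part[of n] by (auto intro: order_trans ennreal_leI simp: mult_ac)
  qed
  have un: "(\<Union>n. F \<inter> {c<..X n}) = F \<inter> {c<..<d}"
  proof (intro equalityI subsetI)
    fix x assume x: "x \<in> F \<inter> {c<..<d}"
    obtain n where "(d - c) / (d - x) < 2 ^ n" using real_arch_pow[of 2 "(d - c) / (d - x)"] by auto
    then have "(d - c) / 2 ^ n < d - x" using x by (simp add: field_simps)
    then show "x \<in> (\<Union>n. F \<inter> {c<..X n})" using x by (auto simp: X_def intro!: exI[of _ n])
  qed (use X_less in \<open>auto intro: le_less_trans\<close>)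
  have "incseq X" by (rule incseq_SucI) (use X_mono less_imp_le in blast)
  then have inc: "incseq (\<lambda>n. F \<inter> {c<..X n})"
    by (force simp: incseq_def)
  have "weight_of w (F \<inter> {c<..<d}) = (SUP n. weight_of w (F \<inter> {c<..X n}))"
  proof -
    have sets: "F \<inter> {c<..X n} \<in> sets lebesgue" "F \<inter> {c<..<d} \<in> sets lebesgue" for n using F by auto
    then have "(SUP n. emeasure \<mu> (F \<inter> {c<..X n})) = emeasure \<mu> (\<Union>n. F \<inter> {c<..X n})"
      using inc by (intro SUP_emeasure_incseq) auto
    then show ?thesis using sets by (simp only: un weight_eq)
  qed
  also have "\<dots> \<le> ennreal (2 * \<eta> * (W d - W c))" by (intro SUP_least bound)
  also have "\<dots> = ennreal (2 * \<eta>) * weight_of w {c<..<d}"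
    using weight_Ioo[of c d] cd \<eta> by (simp add: ennreal_mult')
  finally show ?thesis by (simp add: \<eta>_def)
qed

end

section \<open>Solyanik estimates\<close>

lemma bounded_maximal_superlevel:
  assumes E: "E \<in> sets lebesgue" "E \<subseteq> {- r..r}" and \<alpha>: "0 < \<alpha>"
  shows "bounded {x. maximal_forward (indicator E) x > ennreal \<alpha>}"
proof -
  obtain V where V: "primitive V (indicator E)"
    using primitive_exists[OF locally_integrable_indicator[OF E(1)]] .
  have "x \<in> {- r - 2 * r / \<alpha>..r}" if less: "ennreal \<alpha> < maximal_forward (indicator E) x" for x
  proof -
    obtain y where y: "x < y" "\<alpha> * (y - x) < V y - V x"
      using less maximal_forward_gt_iff[OF V, of \<alpha> x] \<alpha> by auto
    then have pos: "0 < V y - V x" using \<alpha> by (meson diff_gt_0_iff_gt less_trans mult_pos_pos)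
    then have "E \<inter> {x..y} \<noteq> {}" using primitive_indicator[OF V E(1), of x y] y by auto
    then obtain e where e: "e \<in> E" "x \<le> e" "e \<le> y" by auto
    with E(2) have er: "- r \<le> e" "e \<le> r" by auto
    have "ennreal (V y - V x) \<le> emeasure lebesgue {- r..r}"
      unfolding primitive_indicator[OF V E(1) less_imp_le[OF y(1)], symmetric]
      by (rule emeasure_mono) (use E(2) in auto)
    then have "V y - V x \<le> 2 * r" using er pos by simp
    then have "y - x < 2 * r / \<alpha>" using y(2) \<alpha> by (simp add: pos_less_divide_eq mult.commute)
    then have "- r - 2 * r / \<alpha> \<le> x" "x \<le> r" using e er by linarith+
    then show ?thesis by simp
  qed
  then have "{x. maximal_forward (indicator E) x > ennreal \<alpha>} \<subseteq> {- r - 2 * r / \<alpha>..r}"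
    by blast
  then show ?thesis by (rule bounded_subset[OF bounded_closed_interval])
qed

text \<open>The rising sun lemma for \<open>V t - \<alpha> t\<close>, where \<open>V\<close> is a primitive of \<open>1\<^bsub>E\<^esub>\<close>.  The left endpoint of the
  component is included by continuity.\<close>

lemma superlevel_component_thin:
  assumes E: "E \<in> sets lebesgue" and \<alpha>: "0 < \<alpha>"
    and comp: "{c<..<d} \<subseteq> {x. maximal_forward (indicator E) x > ennreal \<alpha>}"
      "d \<notin> {x. maximal_forward (indicator E) x > ennreal \<alpha>}"
    and x: "x \<in> {c..<d}"
  shows "emeasure lebesgue (- E \<inter> {x<..<d}) \<le> ennreal ((1 - \<alpha>) * (d - x))"
proof -
  obtain V where V: "primitive V (indicator E)"
    using primitive_exists[OF locally_integrable_indicator[OF E]] .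
  define \<psi> where "\<psi> t = V t - \<alpha> * t" for t
  have cont: "continuous_on S \<psi>" for S
    unfolding \<psi>_def by (intro continuous_intros primitiveD(1)[OF V])
  have iff: "ennreal \<alpha> < maximal_forward (indicator E) t \<longleftrightarrow> (\<exists>y>t. \<psi> t < \<psi> y)" for t
    using maximal_forward_gt_iff[OF V, of \<alpha> t] \<alpha> by (simp add: \<psi>_def algebra_simps)
  have inner: "\<psi> t \<le> \<psi> d" if "t \<in> {c<..<d}" for t
    using comp iff by (intro rising_sun_right[OF cont _ _ that]) auto
  have "\<psi> x \<le> \<psi> d"
  proof (rule continuous_le_on_closure[OF cont _ inner])
    show "x \<in> closure {c<..<d}" using x by (simp add: closure_greaterThanLessThan)
  qed
  then have V_ge: "\<alpha> * (d - x) \<le> V d - V x" by (simp add: \<psi>_def algebra_simps)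
  have "emeasure lebesgue (- E \<inter> {x<..<d}) \<le> emeasure lebesgue ({x..d} - E \<inter> {x..d})"
    by (intro emeasure_mono sets.Diff sets.Int E) auto
  also have "\<dots> = ennreal (d - x) - ennreal (V d - V x)"
  proof -
    have "emeasure lebesgue {x..d} = ennreal (d - x)" using x by simp
    then show ?thesis
      using E x by (subst emeasure_Diff) (auto simp: primitive_indicator[OF V E] simp del: emeasure_completion)
  qed
  also have "\<dots> \<le> ennreal ((1 - \<alpha>) * (d - x))"
    using V_ge x primitiveD(3)[OF V, of x d] by (subst ennreal_minus) (auto intro!: ennreal_leI simp: algebra_simps)
  finally show ?thesis .
qed

text \<open>The bound \<open>1 / (1 - \<eta>) \<le> 1 + 2 \<eta>\<close> for \<open>\<eta> \<le> 1 / 2\<close>, in a form without division.\<close>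

lemma real_absorb:
  fixes u e \<eta> :: real
  assumes "u \<le> e + \<eta> * u" "0 \<le> \<eta>" "\<eta> \<le> 1 / 2" "0 \<le> e"
  shows "u \<le> (1 + 2 * \<eta>) * e"
proof -
  have "(1 - \<eta>) * u \<le> e" using assms(1) by (simp add: algebra_simps)
  also have "e \<le> ((1 - \<eta>) * (1 + 2 * \<eta>)) * e"
  proof -
    have "\<eta> * \<eta> \<le> \<eta> * (1 / 2)" using assms by (intro mult_left_mono) auto
    then have "1 \<le> (1 - \<eta>) * (1 + 2 * \<eta>)" by (simp add: algebra_simps)
    then show ?thesis using mult_right_mono[of 1 _ e] assms(4) by simp
  qed
  finally have "(1 - \<eta>) * u \<le> (1 - \<eta>) * ((1 + 2 * \<eta>) * e)" by (simp add: mult.assoc)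
  then show ?thesis using assms by (subst (asm) mult_le_cancel_left_pos) auto
qed

text \<open>The choice \<open>4\<^sup>k \<approx> 1 / s\<close> turns \<open>s 2\<^sup>k\<close> into about \<open>s\<^sup>1\<^sup>/\<^sup>2\<close>, and \<open>\<rho>\<^sup>k\<close> into a power of \<open>s\<close> with
  exponent \<open>log\<^sub>4 (1 / \<rho>)\<close>.\<close>

lemma dyadic_geometric_tradeoff:
  fixes \<rho> A :: real
  assumes \<rho>: "0 < \<rho>" "\<rho> < 1" and A: "0 \<le> A"
  obtains \<delta> C where "0 < \<delta>" "0 < C"
    "\<And>s. 0 < s \<Longrightarrow> s < 1 \<Longrightarrow> \<exists>k. 8 * s * 2 ^ k + A * \<rho> ^ k \<le> C * s powr \<delta>"
proof -
  define \<delta>' where "\<delta>' = - ln \<rho> / ln 4"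
  define \<delta> where "\<delta> = min (1 / 2) \<delta>'"
  define C where "C = 8 + A / \<rho>"
  have "0 < \<delta>'" using \<rho> by (simp add: \<delta>'_def divide_neg_pos)
  then have \<delta>: "0 < \<delta>" "\<delta> \<le> 1 / 2" "\<delta> \<le> \<delta>'" by (auto simp: \<delta>_def)
  have C: "0 < C" using A \<rho> by (simp add: C_def add_pos_nonneg)
  have "\<exists>k. 8 * s * 2 ^ k + A * \<rho> ^ k \<le> C * s powr \<delta>" if s: "0 < s" "s < 1" for s :: real
  proof -
    define L where "L = - ln s / ln 4"
    have L: "0 < L" using s by (simp add: L_def divide_neg_pos)
    define k where "k = nat \<lfloor>L\<rfloor>"
    have k: "real k \<le> L" "L - 1 \<le> real k" using L by (auto simp: k_def)
    have ln4: "ln (4::real) = 2 * ln 2" using ln_realpow[of 2 2] by simp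
    have "(2::real) ^ k = 2 powr real k" by (simp add: powr_realpow)
    also have "\<dots> \<le> 2 powr L" using k by simp
    also have "\<dots> = s powr (- (1 / 2))" using s by (simp add: powr_def L_def ln4)
    finally have "s * 2 ^ k \<le> s powr 1 * s powr (- (1 / 2))" using s by simp
    also have "\<dots> = s powr (1 + - (1 / 2))" by (simp only: powr_add)
    also have "1 + - (1 / 2) = (1 / 2 :: real)" by simp
    also have "s powr (1 / 2) \<le> s powr \<delta>" using s \<delta> by (intro powr_mono') auto
    finally have 1: "s * 2 ^ k \<le> s powr \<delta>" .
    have "\<rho> ^ k = \<rho> powr real k" using \<rho> by (simp add: powr_realpow)
    also have "\<dots> \<le> \<rho> powr (L - 1)" using k \<rho> by (intro powr_mono') auto
    also have "\<dots> = \<rho> powr L / \<rho>" using \<rho> by (simp add: powr_diff)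
    also have "\<rho> powr L = s powr \<delta>'" using s \<rho> by (simp add: powr_def L_def \<delta>'_def)
    also have "s powr \<delta>' / \<rho> \<le> s powr \<delta> / \<rho>"
      using s \<delta> \<rho> by (intro divide_right_mono powr_mono') auto
    finally have "A * \<rho> ^ k \<le> A * (s powr \<delta> / \<rho>)" using A by (rule mult_left_mono)
    with 1 have "8 * s * 2 ^ k + A * \<rho> ^ k \<le> 8 * s powr \<delta> + A * (s powr \<delta> / \<rho>)" by simp
    also have "\<dots> = C * s powr \<delta>" by (simp add: C_def algebra_simps)
    finally show ?thesis by blast
  qed
  with \<delta>(1) C show ?thesis by (rule that)
qed

context A_infty_weight
begin

text \<open>The value of the bound in \<open>weight_thin_le\<close> for a set that fills at most the fraction \<open>s\<close> of
  every interval ending at \<open>d\<close>; the integer \<open>k\<close> remains to be chosen.\<close>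

definition eta :: "real \<Rightarrow> nat \<Rightarrow> real" where
  "eta s k = 2 * (8 * s * 2 ^ k + A * rho ^ k)"

text \<open>On each component of \<open>U\<close> the complement of \<open>E\<close> is thin seen from the right endpoint.\<close>

lemma weight_superlevel_diff_le:
  assumes E: "E \<in> sets lebesgue" "E \<subseteq> {- r..r}" and \<alpha>: "0 < \<alpha>" "\<alpha> < 1"
  defines "U \<equiv> {x. maximal_forward (indicator E) x > ennreal \<alpha>}"
  shows "weight_of w (U - E) \<le> ennreal (eta (1 - \<alpha>) k) * weight_of w U"
proof -
  let ?\<eta> = "ennreal (eta (1 - \<alpha>) k)"
  obtain V where V: "primitive V (indicator E)"
    using primitive_exists[OF locally_integrable_indicator[OF E(1)]] .
  have U: "open U" "bounded U"
    unfolding U_def using \<alpha> open_maximal_forward_gt[OF V] bounded_maximal_superlevel[OF E] by auto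
  have "weight_of w (U - E) = (\<integral>\<^sup>+ x \<in> U. ennreal (w x) * indicator (- E) x \<partial>lebesgue)"
    unfolding weight_of_def by (intro nn_integral_cong) (auto simp: indicator_def)
  also have "\<dots> \<le> (\<integral>\<^sup>+ x \<in> U. ?\<eta> * ennreal (w x) \<partial>lebesgue)"
  proof (rule nn_integral_mono_components[OF U])
    fix c d assume cd: "c < d" "{c<..<d} \<subseteq> U" "c \<notin> U" "d \<notin> U"
    have "(\<integral>\<^sup>+ x \<in> {c<..<d}. ennreal (w x) * indicator (- E) x \<partial>lebesgue) = weight_of w (- E \<inter> {c<..<d})"
      unfolding weight_of_def by (intro nn_integral_cong) (auto simp: indicator_def)
    also have "\<dots> \<le> ?\<eta> * weight_of w {c<..<d}"
      unfolding eta_def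
    proof (rule weight_thin_le[OF cd(1)])
      show "- E \<in> sets lebesgue" using sets.compl_sets[OF E(1)] by (simp add: Compl_eq_Diff_UNIV)
      show "emeasure lebesgue (- E \<inter> {x<..<d}) \<le> ennreal ((1 - \<alpha>) * (d - x))" if "x \<in> {c..<d}" for x
        using superlevel_component_thin[OF E(1) \<alpha>(1) _ _ that] cd unfolding U_def by blast
    qed (use \<alpha> in auto)
    also have "\<dots> = (\<integral>\<^sup>+ x \<in> {c<..<d}. ?\<eta> * ennreal (w x) \<partial>lebesgue)"
      unfolding weight_of_def
      by (subst nn_integral_cmult[symmetric])
        (auto intro!: borel_measurable_times_ennreal measurable_ennreal_w borel_measurable_indicator simp: mult.assoc)
    finally show "(\<integral>\<^sup>+ x \<in> {c<..<d}. ennreal (w x) * indicator (- E) x \<partial>lebesgue)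
        \<le> (\<integral>\<^sup>+ x \<in> {c<..<d}. ?\<eta> * ennreal (w x) \<partial>lebesgue)" .
  qed (use sets.compl_sets[OF E(1)] in \<open>auto intro!: borel_measurable_times_ennreal measurable_ennreal_w
      borel_measurable_indicator simp: Compl_eq_Diff_UNIV\<close>)
  also have "\<dots> = ?\<eta> * weight_of w U"
    unfolding weight_of_def using U(1)
    by (subst nn_integral_cmult[symmetric])
      (auto intro!: borel_measurable_times_ennreal measurable_ennreal_w borel_measurable_indicator
        borel_open simp: mult.assoc)
  finally show ?thesis .
qed

text \<open>Boundedness of \<open>E\<close> makes the weight of the superlevel set finite, so that the term \<open>\<eta> w(U)\<close> on the
  right-hand side can be absorbed.\<close>

lemma weight_superlevel_bounded_le:
  assumes E: "E \<in> sets lebesgue" "E \<subseteq> {- r..r}" and \<alpha>: "0 < \<alpha>" "\<alpha> < 1"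
    and small: "eta (1 - \<alpha>) k \<le> 1 / 2"
  shows "weight_of w {x. maximal_forward (indicator E) x > ennreal \<alpha>}
    \<le> ennreal (1 + 2 * eta (1 - \<alpha>) k) * weight_of w E"
proof -
  define U where "U = {x. maximal_forward (indicator E) x > ennreal \<alpha>}"
  define \<eta> where "\<eta> = eta (1 - \<alpha>) k"
  have \<eta>: "0 \<le> \<eta>" "\<eta> \<le> 1 / 2" using small \<alpha> A rho by (auto simp: \<eta>_def eta_def)
  have finite: "weight_of w S < \<infinity>" if "S \<subseteq> {- R..R}" for S R
  proof -
    have "weight_of w S \<le> weight_of w {- \<bar>R\<bar>..\<bar>R\<bar>}"
      by (rule weight_mono) (use that in auto)
    then show ?thesis by (simp add: weight_Icc le_less_trans)
  qed
  obtain V where V: "primitive V (indicator E)"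
    using primitive_exists[OF locally_integrable_indicator[OF E(1)]] .
  have U: "open U" "bounded U"
    unfolding U_def using \<alpha> open_maximal_forward_gt[OF V] bounded_maximal_superlevel[OF E] by auto
  obtain R where "U \<subseteq> {- R..R}"
    using U(2) by (auto simp: bounded_iff abs_le_iff subset_iff minus_le_iff)
  from finite[OF this] obtain u where u: "weight_of w U = ennreal u" "0 \<le> u"
    by (cases "weight_of w U") auto
  from finite[OF E(2)] obtain e where e: "weight_of w E = ennreal e" "0 \<le> e"
    by (cases "weight_of w E") auto
  have sets: "U \<in> sets lebesgue" using U(1) by (auto intro: borel_open)
  have "weight_of w U \<le> weight_of w (E \<union> (U - E))" by (rule weight_mono) auto
  also have "\<dots> \<le> weight_of w E + weight_of w (U - E)"
  proof -
    have "U - E \<in> sets lebesgue" using sets E by auto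
    then show ?thesis using E(1) sets.Un[OF E(1) \<open>U - E \<in> sets lebesgue\<close>]
      by (simp only: weight_eq emeasure_subadditive sets_density)
  qed
  also have "\<dots> \<le> weight_of w E + ennreal \<eta> * weight_of w U"
    using weight_superlevel_diff_le[OF E \<alpha>] unfolding U_def \<eta>_def by (rule add_left_mono)
  finally have "u \<le> e + \<eta> * u"
    using \<eta> u e by (simp add: ennreal_mult'[symmetric] flip: ennreal_plus)
  from real_absorb[OF this \<eta> e(2)] show ?thesis
    using \<eta> e u by (simp add: U_def[symmetric] \<eta>_def[symmetric] ennreal_mult'[symmetric] ennreal_leI del: ennreal_plus)
qed

text \<open>The superlevel set of \<open>E\<close> is the increasing union of those of the bounded sets \<open>E \<inter> [-n, n]\<close>,
  because each average involves only a bounded interval.\<close>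

lemma weight_superlevel_le:
  assumes E: "E \<in> sets lebesgue" and \<alpha>: "0 < \<alpha>" "\<alpha> < 1"
    and small: "eta (1 - \<alpha>) k \<le> 1 / 2"
  shows "weight_of w {x. maximal_forward (indicator E) x > ennreal \<alpha>}
    \<le> ennreal (1 + 2 * eta (1 - \<alpha>) k) * weight_of w E"
proof -
  define En where "En n = E \<inter> {- real n..real n}" for n
  define U where "U n = {x. maximal_forward (indicator (En n)) x > ennreal \<alpha>}" for n
  have En: "En n \<in> sets lebesgue" for n using E by (auto simp: En_def)
  have avg_mono: "maximal_forward (indicator S) x \<le> maximal_forward (indicator T) x" if "S \<subseteq> T" for S T x
    unfolding maximal_forward_def
    by (intro SUP_mono' divide_right_mono_ennreal nn_integral_mono) (use that in \<open>auto simp: indicator_def\<close>)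
  have En_mono: "En n \<subseteq> En (Suc n)" for n by (auto simp: En_def)
  have incU: "incseq U"
  proof (rule incseq_SucI)
    fix n show "U n \<subseteq> U (Suc n)"
      using avg_mono[of "En n" "En (Suc n)"] En_mono[of n] by (auto simp: U_def intro: less_le_trans)
  qed
  have setsU: "U n \<in> sets lebesgue" for n
  proof -
    obtain V where V: "primitive V (indicator (En n))"
      using primitive_exists[OF locally_integrable_indicator[OF En]] .
    show ?thesis unfolding U_def using open_maximal_forward_gt[OF V, of \<alpha>] \<alpha> by (auto intro: borel_open)
  qed
  have sub: "{x. maximal_forward (indicator E) x > ennreal \<alpha>} \<subseteq> (\<Union>n. U n)"
  proof
    fix x assume "x \<in> {x. maximal_forward (indicator E) x > ennreal \<alpha>}"
    then obtain h where h: "0 < h"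
      "ennreal \<alpha> < (\<integral>\<^sup>+ t \<in> {x..x + h}. ennreal \<bar>indicator E t\<bar> \<partial>lebesgue) / ennreal h"
      by (auto simp: maximal_forward_def less_SUP_iff)
    obtain n where n: "\<bar>x\<bar> + h \<le> real n" using real_arch_simple by blast
    have "(\<integral>\<^sup>+ t \<in> {x..x + h}. ennreal \<bar>indicator E t\<bar> \<partial>lebesgue)
        = (\<integral>\<^sup>+ t \<in> {x..x + h}. ennreal \<bar>indicator (En n) t\<bar> \<partial>lebesgue)"
      using n by (intro nn_integral_cong) (auto simp: En_def indicator_def)
    with h have "ennreal \<alpha> < maximal_forward (indicator (En n)) x"
      unfolding maximal_forward_def less_SUP_iff by (intro bexI[of _ h]) auto
    then show "x \<in> (\<Union>n. U n)" by (auto simp: U_def)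
  qed
  have "weight_of w {x. maximal_forward (indicator E) x > ennreal \<alpha>} \<le> weight_of w (\<Union>n. U n)"
    by (rule weight_mono[OF sub])
  also have "\<dots> = (SUP n. weight_of w (U n))"
  proof -
    have "(SUP n. emeasure \<mu> (U n)) = emeasure \<mu> (\<Union>n. U n)"
      using setsU incU by (intro SUP_emeasure_incseq) auto
    moreover have "(\<Union>n. U n) \<in> sets lebesgue" using setsU by auto
    ultimately show ?thesis by (simp add: weight_eq setsU)
  qed
  also have "\<dots> \<le> ennreal (1 + 2 * eta (1 - \<alpha>) k) * weight_of w E"
  proof (rule SUP_least)
    fix n
    have "weight_of w (U n) \<le> ennreal (1 + 2 * eta (1 - \<alpha>) k) * weight_of w (En n)"
      unfolding U_def by (rule weight_superlevel_bounded_le[OF En _ \<alpha> small, of _ "real n"]) (simp add: En_def)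
    also have "\<dots> \<le> ennreal (1 + 2 * eta (1 - \<alpha>) k) * weight_of w E"
      by (intro mult_left_mono weight_mono) (auto simp: En_def)
    finally show "weight_of w (U n) \<le> ennreal (1 + 2 * eta (1 - \<alpha>) k) * weight_of w E" .
  qed
  finally show ?thesis .
qed

lemma tauberian_plus_le:
  assumes \<alpha>: "0 < \<alpha>" "\<alpha> < 1" and small: "eta (1 - \<alpha>) k \<le> 1 / 2"
  shows "tauberian_plus w \<alpha> \<le> ennreal (1 + 2 * eta (1 - \<alpha>) k)"
  unfolding tauberian_plus_def
proof (rule SUP_least)
  fix E assume "E \<in> {E \<in> sets lebesgue. 0 < weight_of w E \<and> weight_of w E < \<infinity>}"
  then show "weight_of w {x. ennreal \<alpha> < maximal_forward (indicator E) x} / weight_of w E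
      \<le> ennreal (1 + 2 * eta (1 - \<alpha>) k)"
    using weight_superlevel_le[OF _ \<alpha> small, of E]
    by (intro divide_le_posI_ennreal) (auto simp: mult.commute)
qed

lemma solyanik_estimate:
  "\<exists>\<delta>>0. \<exists>C>0. \<exists>\<alpha>\<^sub>1\<in>{0<..<1}. \<forall>\<alpha>\<in>{\<alpha>\<^sub>1<..<1}.
      enn2ereal (tauberian_plus w \<alpha>) - 1 \<le> ereal (C * (1 - \<alpha>) powr \<delta>)"
proof -
  obtain \<delta> C where \<delta>: "0 < \<delta>" and C: "0 < C"
    and scale: "\<And>s. 0 < s \<Longrightarrow> s < 1 \<Longrightarrow> \<exists>k. 8 * s * 2 ^ k + A * rho ^ k \<le> C * s powr \<delta>"
    using dyadic_geometric_tradeoff[OF rho, of A] A by auto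
  \<comment> \<open>The threshold makes \<open>C * s powr \<delta>\<close> at most \<open>1 / 4\<close>, so that the absorption argument applies.\<close>
  define s\<^sub>1 where "s\<^sub>1 = min (1 / 2) ((1 / (4 * C)) powr (1 / \<delta>))"
  have s1: "0 < s\<^sub>1" "s\<^sub>1 < 1" using C by (auto simp: s\<^sub>1_def)
  have "enn2ereal (tauberian_plus w \<alpha>) - 1 \<le> ereal (4 * C * (1 - \<alpha>) powr \<delta>)" if \<alpha>: "\<alpha> \<in> {1 - s\<^sub>1<..<1}" for \<alpha>
  proof -
    define s where "s = 1 - \<alpha>"
    have s: "0 < s" "s < s\<^sub>1" "s < 1" using \<alpha> s1 by (auto simp: s_def)
    obtain k where k: "8 * s * 2 ^ k + A * rho ^ k \<le> C * s powr \<delta>" using scale s by blast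
    have "s powr \<delta> \<le> ((1 / (4 * C)) powr (1 / \<delta>)) powr \<delta>"
      using s \<delta> by (intro powr_mono2) (auto simp: s\<^sub>1_def)
    also have "\<dots> = 1 / (4 * C)" using \<delta> C by (simp add: powr_powr)
    finally have "C * s powr \<delta> \<le> 1 / 4" using C by (simp add: field_simps)
    then have small: "eta s k \<le> 1 / 2" using k by (simp add: eta_def)
    have "tauberian_plus w \<alpha> \<le> ennreal (1 + 2 * eta s k)"
      unfolding s_def by (rule tauberian_plus_le) (use \<alpha> s1 small in \<open>auto simp: s_def\<close>)
    also have "\<dots> \<le> ennreal (1 + 4 * C * s powr \<delta>)"
      using k by (intro ennreal_leI) (simp add: eta_def)
    finally have "enn2ereal (tauberian_plus w \<alpha>) \<le> ereal (1 + 4 * C * s powr \<delta>)"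
      using C by (simp add: less_eq_ennreal.rep_eq enn2ereal_ennreal del: ennreal_plus)
    then have "enn2ereal (tauberian_plus w \<alpha>) - 1 \<le> ereal (1 + 4 * C * s powr \<delta>) - 1"
      by (rule ereal_minus_mono) simp
    also have "\<dots> = ereal (4 * C * s powr \<delta>)" by (simp add: one_ereal_def)
    finally show ?thesis by (simp add: s_def)
  qed
  then show ?thesis
    using \<delta> C s1 by (intro exI[of _ \<delta>] conjI exI[of _ "4 * C"] bexI[of _ "1 - s\<^sub>1"]) auto
qed

end

section \<open>The equivalence\<close>

theorem theorem1p1:
  fixes w :: "real \<Rightarrow> real"
  assumes nonneg: "\<And>x. 0 \<le> w x"
    and loc_int: "locally_integrable w"
  shows "(A_infty_plus w \<longleftrightarrow>
           (\<exists>\<delta>>0. \<exists>C>0. \<exists>\<alpha>\<^sub>1\<in>{0<..<1}. \<forall>\<alpha>\<in>{\<alpha>\<^sub>1<..<1}.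
              enn2ereal (tauberian_plus w \<alpha>) - 1 \<le> ereal (C * (1 - \<alpha>) powr \<delta>)))
       \<and> (A_infty_plus w \<longleftrightarrow>
           (\<exists>\<alpha>\<^sub>0\<in>{0<..<1}. tauberian_plus w \<alpha>\<^sub>0 < \<infinity>))"
    (is "(?i \<longleftrightarrow> ?ii) \<and> (?i \<longleftrightarrow> ?iii)")
proof -
  obtain W where "primitive W w" using primitive_exists[OF loc_int] .
  then interpret weight w W by unfold_locales (use nonneg loc_int in auto)
  have i_ii: ?ii if i: ?i
  proof -
    obtain A where "1 \<le> A"
      "\<forall>a b. a < b \<longrightarrow> (\<integral>\<^sup>+ x \<in> {a<..<b}. M a b x \<partial>lebesgue) \<le> ennreal (A * (W b - W a))"
      using A_infty_plusD[OF i] by blast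
    then interpret A_infty_weight w W A by unfold_locales auto
    show ?ii by (rule solyanik_estimate)
  qed
  have ii_iii: ?iii if ?ii
  proof -
    from that obtain \<delta> C \<alpha>\<^sub>1 where *: "\<alpha>\<^sub>1 \<in> {0<..<1}"
      "\<And>\<alpha>. \<alpha> \<in> {\<alpha>\<^sub>1<..<1} \<Longrightarrow> enn2ereal (tauberian_plus w \<alpha>) - 1 \<le> ereal (C * (1 - \<alpha>) powr \<delta>)"
      by blast
    define \<alpha> where "\<alpha> = (\<alpha>\<^sub>1 + 1) / 2"
    have \<alpha>: "\<alpha> \<in> {\<alpha>\<^sub>1<..<1}" "\<alpha> \<in> {0<..<1}" using *(1) by (auto simp: \<alpha>_def)
    have "tauberian_plus w \<alpha> \<noteq> top"
    proof
      assume "tauberian_plus w \<alpha> = top"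
      then show False using *(2)[OF \<alpha>(1)] by (simp add: enn2ereal_top)
    qed
    then show ?iii using \<alpha>(2) by (auto simp: less_top)
  qed
  have iii_i: ?i if ?iii
    using that tauberian_imp_A_infty_plus by auto
  from i_ii ii_iii iii_i show ?thesis by blast
qed

end
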